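(* There is a set $A$ which is $\omega$-c.e. (i.e. $A\le_{wtt}\emptyset'$) and jump traceable but not BLR traceable.
   Context: An order function is a computable nondecreasing unbounded function. $A$ is jump traceable if there is an order function $h$ and a uniformly c.e. sequence of finite sets $(T_x)$ with $|T_x|\le h(x)$ such that $J^A(x)\in T_x$ whenever $J^A(x)\downarrow$, where $J^A$ is the universal $A$-partial computable function (the jump function). A function is $\omega$-c.e. by $A$ if it is $\lim_t\Gamma^A(x,t)$ for an $A$-computable $\Gamma^A$ whose number of changes at $x$ is bounded by a computable function. A BLR trace is $(T_n)$ with $T_n=W_{r(n)}$ for an $\omega$-c.e. function $r$ (limit of a computable approximation with computably bounded number of changes); bound $h$ means $|T_n|\le h(n)$. $A$ is BLR traceable if for some order $h$, every function $f$ that is $\omega$-c.e. by $A$ has a BLR trace with bound $h$ containing $f(n)$ in $T_n$ for all $n$. *)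

theory Defs
  imports Main "HOL-Library.Nat_Bijection"
begin

datatype rf = Zero | Succ | Proj nat | Oracle | Comp rf "rf list" | Prim rf rf | Mn rf

definition arg0 :: "nat list \<Rightarrow> nat" where
  "arg0 xs = (case xs of [] \<Rightarrow> 0 | x # _ \<Rightarrow> x)"

inductive eval :: "nat set \<Rightarrow> rf \<Rightarrow> nat list \<Rightarrow> nat \<Rightarrow> bool" for A :: "nat set" where
  ev_zero: "eval A Zero xs 0"
| ev_succ: "eval A Succ xs (Suc (arg0 xs))"
| ev_proj: "eval A (Proj i) xs (if i < length xs then xs ! i else 0)"
| ev_oracle: "eval A Oracle xs (if arg0 xs \<in> A then 1 else 0)"
| ev_comp: "list_all2 (\<lambda>g y. eval A g xs y) gs ys \<Longrightarrow> eval A f ys z \<Longrightarrow> eval A (Comp f gs) xs z"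
| ev_prim0: "eval A f xs y \<Longrightarrow> eval A (Prim f g) (0 # xs) y"
| ev_primS: "eval A (Prim f g) (n # xs) r \<Longrightarrow> eval A g (r # n # xs) y \<Longrightarrow> eval A (Prim f g) (Suc n # xs) y"
| ev_mn: "eval A f (y # xs) 0 \<Longrightarrow> (\<forall>z<y. \<exists>v. v \<noteq> 0 \<and> eval A f (z # xs) v) \<Longrightarrow> eval A (Mn f) xs y"

fun dec :: "nat \<Rightarrow> nat \<Rightarrow> rf" and decl :: "nat \<Rightarrow> nat \<Rightarrow> rf list" where
  "dec 0 n = Zero"
| "dec (Suc k) n =
     (let c = n mod 7; m = n div 7 in
      if c = 0 then Zero else if c = 1 then Succ else if c = 2 then Proj m
      else if c = 3 then Oracle
      else if c = 4 then Comp (dec k (fst (prod_decode m))) (decl k (snd (prod_decode m)))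
      else if c = 5 then Prim (dec k (fst (prod_decode m))) (dec k (snd (prod_decode m)))
      else Mn (dec k m))"
| "decl 0 n = []"
| "decl (Suc k) n =
     (if n = 0 then [] else dec k (fst (prod_decode (n - 1))) # decl k (snd (prod_decode (n - 1))))"

definition decode :: "nat \<Rightarrow> rf" where "decode e = dec (Suc e) e"

definition phi :: "nat set \<Rightarrow> nat \<Rightarrow> nat \<Rightarrow> nat option" where
  "phi A e x = (if \<exists>y. eval A (decode e) [x] y then Some (THE y. eval A (decode e) [x] y) else None)"

definition J :: "nat set \<Rightarrow> nat \<Rightarrow> nat option" where
  "J A x = phi A x x"

definition W :: "nat \<Rightarrow> nat set" where
  "W e = {x. \<exists>y. eval {} (decode e) [x] y}"

definition computable1 :: "(nat \<Rightarrow> nat) \<Rightarrow> bool" where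
  "computable1 f \<longleftrightarrow> (\<exists>t. \<forall>x. eval {} t [x] (f x))"

definition rel_computable2 :: "nat set \<Rightarrow> (nat \<Rightarrow> nat \<Rightarrow> nat) \<Rightarrow> bool" where
  "rel_computable2 A g \<longleftrightarrow> (\<exists>t. \<forall>x s. eval A t [x, s] (g x s))"

definition order_fn :: "(nat \<Rightarrow> nat) \<Rightarrow> bool" where
  "order_fn h \<longleftrightarrow> computable1 h \<and> mono h \<and> (\<forall>m. \<exists>n. m \<le> h n)"

definition unif_ce :: "(nat \<Rightarrow> nat set) \<Rightarrow> bool" where
  "unif_ce T \<longleftrightarrow> (\<exists>t. \<forall>x y. y \<in> T x \<longleftrightarrow> (\<exists>z. eval {} t [x, y] z))"

definition jump_traceable :: "nat set \<Rightarrow> bool" where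
  "jump_traceable A \<longleftrightarrow>
     (\<exists>h T. order_fn h \<and> unif_ce T \<and> (\<forall>x. finite (T x) \<and> card (T x) \<le> h x) \<and>
            (\<forall>x y. J A x = Some y \<longrightarrow> y \<in> T x))"

definition omega_ce_by :: "nat set \<Rightarrow> (nat \<Rightarrow> nat) \<Rightarrow> bool" where
  "omega_ce_by A f \<longleftrightarrow>
     (\<exists>\<Gamma> b. rel_computable2 A \<Gamma> \<and> computable1 b \<and>
        (\<forall>x. finite {t. \<Gamma> x t \<noteq> \<Gamma> x (Suc t)} \<and> card {t. \<Gamma> x t \<noteq> \<Gamma> x (Suc t)} \<le> b x) \<and>
        (\<forall>x. \<exists>t0. \<forall>t\<ge>t0. \<Gamma> x t = f x))"

definition omega_ce_fn :: "(nat \<Rightarrow> nat) \<Rightarrow> bool" where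
  "omega_ce_fn f \<longleftrightarrow> omega_ce_by {} f"

definition omega_ce_set :: "nat set \<Rightarrow> bool" where
  "omega_ce_set A \<longleftrightarrow> omega_ce_fn (\<lambda>x. if x \<in> A then 1 else 0)"

definition BLR_traceable :: "nat set \<Rightarrow> bool" where
  "BLR_traceable A \<longleftrightarrow>
     (\<exists>h. order_fn h \<and>
        (\<forall>f. omega_ce_by A f \<longrightarrow>
           (\<exists>r. omega_ce_fn r \<and>
                (\<forall>n. finite (W (r n)) \<and> card (W (r n)) \<le> h n \<and> f n \<in> W (r n)))))"

end

theory Submission
  imports Defs
begin

text \<open>
  The set is the limit of strings built level by level. Level \<open>n\<close> first extends the current string,
  if it can, to make the jump converge at \<open>n\<close>; this decides the jump up to the guesses of finitely
  many bounded witnesses, so a potential argument gives a trace of computable size. It then appends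
  zeros and finally codes a witness \<open>i\<close> as \<open>i\<close> ones followed by a zero. For the level coding
  \<open>(q, v)\<close> the witness is the least \<open>i\<close> outside the current \<open>q\<close>-th component of the
  \<open>q\<close>-th candidate for a BLR trace, provided that it is at most \<open>v\<close>; for a given order \<open>h\<close>
  the function that sends \<open>q\<close> to the witness at \<open>(q, h q)\<close> therefore has no BLR trace with bound
  \<open>h\<close>. An approximation of this function can be read off the set itself, and changes only when
  the strings at fixed guesses change, which is computably bounded.

  The bound for the changes of a witness is known only once the candidate has converged. The number
  of zeros exceeds this bound, so a witness that can affect whether \<open>x\<close> is in the set changes at
  most \<open>x\<close> times. This is why the set is \<open>\<omega>\<close>-c.e.
\<close>

section \<open>Partial recursive programs\<close>

text \<open>The obstacle is that the changes of a witness are limited only by what its opponent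
  announces, possibly late or never, so no bound computable from the level alone is at hand. The
  size of the jump trace and the number of changes of the approximation relative to the set do need
  such bounds. Both are therefore counted over all guesses at the witnesses, not along their actual
  history: a witness at level \<open>l\<close> is at most \<open>l\<close>, so there are at most
  \<open>n!\<close> guesses of length \<open>n\<close>, and while a guess is held fixed its string
  changes fewer than \<open>3 ^ n\<close> times. This is the origin of
  \<open>fact n * 3 ^ n\<close>. An opponent that breaks its announced bound is abandoned, so these
  counts hold for arbitrary programs in the role of opponents. Opponent \<open>q\<close> is attacked
  at its own argument \<open>q\<close>; since the order \<open>h\<close> is unknown during the
  construction, every size \<open>v\<close> gets a level of its own.\<close>

lemma eval_det:
  assumes "eval A p xs y" and "eval A p xs z"
  shows "y = z"
  using assms
proof (induction arbitrary: z rule: eval.induct)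
  case (ev_comp xs gs ys f y)
  from ev_comp.prems obtain zs where zs: "list_all2 (\<lambda>g y. eval A g xs y) gs zs" "eval A f zs z"
    by (cases rule: eval.cases) auto
  have "ys = zs"
    using ev_comp.IH(1) zs(1)
    by (auto simp: list_all2_conv_all_nth intro!: nth_equalityI)
  then show ?case using ev_comp zs by simp
next
  case (ev_primS f g n xs r y)
  from ev_primS.prems obtain r' where "eval A (Prim f g) (n # xs) r'" "eval A g (r' # n # xs) z"
    by (cases rule: eval.cases) auto
  then show ?case using ev_primS by metis
next
  case (ev_mn f y xs)
  from ev_mn.prems have z: "eval A f (z # xs) 0" "\<forall>i<z. \<exists>v. v \<noteq> 0 \<and> eval A f (i # xs) v"
    by (cases rule: eval.cases, auto)+
  show ?case
    using ev_mn.IH z by (metis linorder_neqE_nat)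
qed (erule eval.cases; auto)+

lemma phi_eq_Some: "phi A e x = Some y \<longleftrightarrow> eval A (decode e) [x] y"
  proof (cases "\<exists>y. eval A (decode e) [x] y")
  case True
  then obtain z where z: "eval A (decode e) [x] z" ..
  then have "(THE y. eval A (decode e) [x] y) = z" by (rule the_equality) (rule eval_det[OF _ z])
  then have "phi A e x = Some z" using True by (simp add: phi_def)
  then show ?thesis using eval_det[OF z, of y] z by auto
qed (simp add: phi_def)

lemma eval_comp1: "eval A g xs y \<Longrightarrow> eval A f [y] z \<Longrightarrow> eval A (Comp f [g]) xs z"
  by (rule ev_comp[of _ _ _ "[y]"]) auto

lemma eval_comp2:
  "eval A g xs y \<Longrightarrow> eval A h xs w \<Longrightarrow> eval A f [y, w] z \<Longrightarrow> eval A (Comp f [g, h]) xs z"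
  by (rule ev_comp[of _ _ _ "[y, w]"]) auto

lemma eval_Proj: "i < length xs \<Longrightarrow> y = xs ! i \<Longrightarrow> eval A (Proj i) xs y"
  using ev_proj[of A i xs] by simp

lemma eval_Succ: "z = Suc x \<Longrightarrow> eval A Succ (x # xs) z"
  using ev_succ[of A "x # xs"] by (simp add: arg0_def)

lemma eval_Prim:
  assumes "eval A f xs z" and "\<And>n r. eval A g (r # n # xs) (s n r)" and "y = rec_nat z s n"
  shows "eval A (Prim f g) (n # xs) y"
  using assms(3)
proof (induction n arbitrary: y)
  case 0
  then show ?case using assms(1) ev_prim0 by simp
next
  case (Suc n)
  show ?case unfolding Suc.prems using ev_primS[OF Suc.IH[OF refl] assms(2)] by simp
qed

lemma eval_Mn:
  assumes "\<And>y. eval A f (y # xs) (g y)" and "\<exists>y. g y = 0"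
  shows "eval A (Mn f) xs (LEAST y. g y = 0)"
proof (rule ev_mn)
  show "eval A f ((LEAST y. g y = 0) # xs) 0"
    using assms(1)[of "LEAST y. g y = 0"] LeastI_ex[OF assms(2)] by simp
  show "\<forall>z<LEAST y. g y = 0. \<exists>v. v \<noteq> 0 \<and> eval A f (z # xs) v"
    using assms(1) not_less_Least by blast
qed

text \<open>Queries to the empty oracle all return 0, so \<open>Zero\<close> can replace them under
  any oracle. This makes an order function, computable outright, available relative to
  \<open>limset\<close>.\<close>

primrec strip :: "rf \<Rightarrow> rf" and strips :: "rf list \<Rightarrow> rf list" where
  "strip Zero = Zero"
| "strip Succ = Succ"
| "strip (Proj i) = Proj i"
| "strip Oracle = Zero"
| "strip (Comp f gs) = Comp (strip f) (strips gs)"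
| "strip (Prim f g) = Prim (strip f) (strip g)"
| "strip (Mn f) = Mn (strip f)"
| "strips [] = []"
| "strips (g # gs) = strip g # strips gs"

lemma strips_map: "strips gs = map strip gs"
  by (induction gs) auto

lemma eval_strip: "eval {} p xs y \<Longrightarrow> eval A (strip p) xs y"
proof (induction rule: eval.induct)
  case (ev_comp xs gs ys f y)
  then show ?case
    by (auto simp: strips_map list_all2_conv_all_nth intro!: eval.ev_comp[of _ _ _ ys])
next
  case (ev_proj i xs)
  then show ?case using eval.ev_proj by simp
next
  case (ev_mn f y xs)
  then show ?case by (auto intro!: eval.ev_mn)
next
  case (ev_primS f g n xs r y)
  show ?case using eval.ev_primS[OF ev_primS.IH[unfolded strip.simps]] by simp
qed (simp_all add: eval.ev_zero eval.ev_succ eval.ev_prim0)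

primrec const_rf :: "nat \<Rightarrow> rf" where
  "const_rf 0 = Zero"
| "const_rf (Suc n) = Comp Succ [const_rf n]"

lemma eval_const_rf: "eval A (const_rf n) xs n"
  by (induction n) (auto intro: ev_zero eval_comp1 eval_Succ)

subsection \<open>Arithmetic and the pairing function\<close>

definition "add_rf = Prim (Proj 0) (Comp Succ [Proj 0])"
definition "pred_rf = Comp (Prim Zero (Proj 1)) [Proj 0]"
definition "sub_rf = Comp (Prim (Proj 0) (Comp pred_rf [Proj 0])) [Proj 1, Proj 0]"
definition "tri_rf = Comp (Prim Zero (Comp add_rf [Proj 0, Comp Succ [Proj 1]])) [Proj 0]"
definition "pair_rf = Comp add_rf [Comp tri_rf [add_rf], Proj 0]"

lemma eval_add_rf: "z = x + y \<Longrightarrow> eval A add_rf [x, y] z"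
  unfolding add_rf_def
proof (rule eval_Prim[where s = "\<lambda>_. Suc" and z = y])
  assume "z = x + y"
  then show "z = rec_nat y (\<lambda>_. Suc) x" by (induction x arbitrary: z) auto
qed (auto intro!: eval_comp1 eval_Succ eval_Proj)

lemmas eval_basic = eval_comp1 eval_comp2 eval_Proj eval_Succ eval_const_rf ev_zero eval_add_rf

lemma eval_pred_rf: "z = x - 1 \<Longrightarrow> eval A pred_rf [x] z"
proof -
  have *: "x - 1 = rec_nat 0 (\<lambda>n _. n) x" by (cases x) auto
  show "z = x - 1 \<Longrightarrow> eval A pred_rf [x] z"
    unfolding pred_rf_def *
    by (rule eval_basic eval_Prim[where s = "\<lambda>n _. n" and z = 0] | simp)+
qed

lemma eval_sub_rf: "z = x - y \<Longrightarrow> eval A sub_rf [x, y] z"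
proof -
  have *: "x - y = rec_nat x (\<lambda>_ r. r - 1) y" by (induction y) auto
  show "z = x - y \<Longrightarrow> eval A sub_rf [x, y] z"
    unfolding sub_rf_def *
    by (rule eval_basic eval_pred_rf eval_Prim[where s = "\<lambda>_ r. r - 1" and z = x] | simp)+
qed

lemma eval_tri_rf: "z = triangle x \<Longrightarrow> eval A tri_rf [x] z"
proof -
  have *: "triangle x = rec_nat 0 (\<lambda>n r. r + Suc n) x" by (induction x) auto
  show "z = triangle x \<Longrightarrow> eval A tri_rf [x] z"
    unfolding tri_rf_def *
    by (rule eval_basic eval_Prim[where s = "\<lambda>n r. r + Suc n" and z = 0] | simp)+
qed

lemma eval_pair_rf: "z = prod_encode (x, y) \<Longrightarrow> eval A pair_rf [x, y] z"
  unfolding pair_rf_def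
  by (rule eval_basic eval_tri_rf | simp add: prod_encode_def)+

text \<open>The sum of the two components coded by a number is the index of its diagonal.\<close>

definition diag :: "nat \<Rightarrow> nat" where
  "diag n = (LEAST s. Suc n - triangle (Suc s) = 0)"

definition "diag_rf = Mn (Comp sub_rf [Comp Succ [Proj 1], Comp tri_rf [Comp Succ [Proj 0]]])"

lemma le_triangle: "n \<le> triangle n"
  by (induction n) auto

lemma triangle_mono: "m \<le> n \<Longrightarrow> triangle m \<le> triangle n"
  by (induction n) (auto simp: le_Suc_eq)

lemma eval_diag_rf: "z = diag n \<Longrightarrow> eval A diag_rf [n] z"
  unfolding diag_rf_def diag_def
proof (erule ssubst, rule eval_Mn)
  show "eval A (Comp sub_rf [Comp Succ [Proj 1], Comp tri_rf [Comp Succ [Proj 0]]]) [y, n]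
          (Suc n - triangle (Suc y))" for y
    by (rule eval_basic eval_tri_rf eval_sub_rf | simp)+
  show "\<exists>y. Suc n - triangle (Suc y) = 0"
    by (rule exI[of _ n]) (use le_triangle[of "Suc n"] in simp)
qed

lemma diag_prod_encode: "diag (prod_encode (x, y)) = x + y"
  unfolding diag_def
proof (rule Least_equality)
  show "Suc (prod_encode (x, y)) - triangle (Suc (x + y)) = 0"
    by (simp add: prod_encode_def)
  fix s assume s: "Suc (prod_encode (x, y)) - triangle (Suc s) = 0"
  show "x + y \<le> s"
  proof (rule ccontr)
    assume "\<not> x + y \<le> s"
    then have "triangle (Suc s) \<le> triangle (x + y)" by (intro triangle_mono) simp
    then show False using s by (simp add: prod_encode_def del: triangle_Suc)
  qed
qed

definition "fst_rf = Comp sub_rf [Proj 0, Comp tri_rf [diag_rf]]"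
definition "snd_rf = Comp sub_rf [diag_rf, fst_rf]"

lemma eval_fst_rf: "z = x \<Longrightarrow> eval A fst_rf [prod_encode (x, y)] z"
  unfolding fst_rf_def
  by (rule eval_basic eval_tri_rf eval_sub_rf eval_diag_rf |
      simp add: diag_prod_encode | simp add: prod_encode_def)+

lemma eval_snd_rf: "z = y \<Longrightarrow> eval A snd_rf [prod_encode (x, y)] z"
  unfolding snd_rf_def
  by (rule eval_basic eval_sub_rf eval_diag_rf eval_fst_rf | simp add: diag_prod_encode)+

section \<open>Computable functions on coded types\<close>

text \<open>Only injectivity is asked of a coding. A program realizing a function is then
  constrained on codes alone, and \<open>bool\<close> can be coded by 0 and 1.\<close>

class coded =
  fixes enc :: "'a \<Rightarrow> nat"
  assumes enc_inject [simp]: "enc x = enc y \<longleftrightarrow> x = y"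

instantiation nat :: coded
begin
definition enc_nat :: "nat \<Rightarrow> nat" where [simp]: "enc_nat n = n"
instance by standard simp
end

instantiation bool :: coded
begin
definition enc_bool :: "bool \<Rightarrow> nat" where [simp]: "enc_bool b = of_bool b"
instance by standard simp
end

instantiation prod :: (coded, coded) coded
begin
definition enc_prod :: "'a \<times> 'b \<Rightarrow> nat" where
  "enc_prod p = prod_encode (enc (fst p), enc (snd p))"
instance by standard (simp add: enc_prod_def prod_eq_iff)
end

instantiation list :: (coded) coded
begin
definition enc_list :: "'a list \<Rightarrow> nat" where "enc_list xs = list_encode (map enc xs)"
instance
proof
  have "inj (enc :: 'a \<Rightarrow> nat)" by (rule injI) simp
  then show "enc xs = enc ys \<longleftrightarrow> xs = ys" for xs ys :: "'a list"
    by (simp add: enc_list_def list_encode_eq inj_map_eq_map)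
qed
end

lemma enc_Pair: "enc (x, y) = prod_encode (enc x, enc y)"
  by (simp add: enc_prod_def)

lemma enc_Nil [simp]: "enc [] = 0"
  by (simp add: enc_list_def)

lemma enc_Cons: "enc (x # xs) = Suc (prod_encode (enc x, enc xs))"
  by (simp add: enc_list_def)

lemma length_le_enc: "length xs \<le> enc xs"
proof (induction xs)
  case (Cons x xs)
  then show ?case using le_prod_encode_2[of "enc xs" "enc x"] by (simp add: enc_Cons)
qed simp

lemma enc_prod_decode: "enc (prod_decode n) = n"
  by (simp add: enc_prod_def)

lemma enc_list_decode: "enc (list_decode n) = n"
  by (simp add: enc_list_def map_idI)

definition computable :: "nat set \<Rightarrow> ('a::coded \<Rightarrow> 'b::coded) \<Rightarrow> bool" where
  "computable A f \<longleftrightarrow> (\<exists>t. \<forall>x. eval A t [enc x] (enc (f x)))"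

named_theorems comp_intros

lemma computableI: "(\<And>x. eval A t [enc x] (enc (f x))) \<Longrightarrow> computable A f"
  unfolding computable_def by blast

lemma computable_cong_enc:
  "computable A f \<Longrightarrow> (\<And>x. enc (g x) = enc (f x)) \<Longrightarrow> computable A g"
  unfolding computable_def by simp

lemma computable_const [comp_intros]: "computable A (\<lambda>x. c)"
  by (rule computableI, rule eval_const_rf)

lemma computable_id [comp_intros]: "computable A (\<lambda>x. x)"
  by (rule computableI[of _ "Proj 0"], rule eval_Proj) simp_all

lemma computable_comp: "computable A f \<Longrightarrow> computable A g \<Longrightarrow> computable A (\<lambda>x. f (g x))"
  unfolding computable_def by (meson eval_comp1)

lemma computable_Pair [comp_intros]:
  "computable A f \<Longrightarrow> computable A g \<Longrightarrow> computable A (\<lambda>x. (f x, g x))"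
  unfolding computable_def enc_Pair by (meson eval_comp2 eval_pair_rf)

lemma computable_comp2:
  assumes "computable A (\<lambda>p. f (fst p) (snd p))" "computable A g" "computable A h"
  shows "computable A (\<lambda>x. f (g x) (h x))"
  using computable_comp[OF assms(1) computable_Pair[OF assms(2,3)]] by simp

lemma computable_comp3:
  assumes "computable A (\<lambda>p. f (fst p) (fst (snd p)) (snd (snd p)))"
    and "computable A g" "computable A h" "computable A k"
  shows "computable A (\<lambda>x. f (g x) (h x) (k x))"
  using computable_comp[OF assms(1) computable_Pair[OF assms(2) computable_Pair[OF assms(3,4)]]]
  by simp

lemma computable_comp4:
  assumes "computable A (\<lambda>p. f (fst p) (fst (snd p)) (fst (snd (snd p))) (snd (snd (snd p))))"
    and "computable A g" "computable A h" "computable A k" "computable A l"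
  shows "computable A (\<lambda>x. f (g x) (h x) (k x) (l x))"
  using computable_comp[OF assms(1) computable_Pair[OF assms(2) computable_Pair[OF assms(3)
    computable_Pair[OF assms(4,5)]]]] by simp

lemma computable_fst [comp_intros]: "computable A f \<Longrightarrow> computable A (\<lambda>x. fst (f x))"
  by (rule computable_comp[of _ fst], rule computableI[of _ fst_rf])
    (auto simp: enc_prod_def intro!: eval_fst_rf)

lemma computable_snd [comp_intros]: "computable A f \<Longrightarrow> computable A (\<lambda>x. snd (f x))"
  by (rule computable_comp[of _ snd], rule computableI[of _ snd_rf])
    (auto simp: enc_prod_def intro!: eval_snd_rf)

lemma computable_Suc [comp_intros]: "computable A f \<Longrightarrow> computable A (\<lambda>x. Suc (f x))"
  by (rule computable_comp[of _ Suc], rule computableI[of _ Succ]) (auto intro!: eval_Succ)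

lemma computable_oracle: "computable A f \<Longrightarrow> computable A (\<lambda>x. f x \<in> A)"
proof (rule computable_comp[of A "\<lambda>n. n \<in> A"], rule computableI[of _ Oracle])
  show "eval A Oracle [enc n] (enc (n \<in> A))" for n
    using ev_oracle[of A "[n]"] by (simp add: arg0_def of_bool_def)
qed

lemma computable_rec_nat [comp_intros]:
  fixes z :: "'a::coded \<Rightarrow> 'b::coded"
  assumes "computable A (\<lambda>p. s (fst p) (fst (snd p)) (snd (snd p)))"
    and "computable A z" "computable A n"
  shows "computable A (\<lambda>x. rec_nat (z x) (s x) (n x))"
proof -
  from assms obtain ts tz tn where
    t: "\<And>p. eval A ts [enc p] (enc (s (fst p) (fst (snd p)) (snd (snd p))))"
      "\<And>x. eval A tz [enc x] (enc (z x))" "\<And>x. eval A tn [enc x] (enc (n x))"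
    unfolding computable_def by blast
  \<comment> \<open>\<open>Prim\<close> supplies the previous value, the counter and the parameter
    in this order; the step program expects them nested the other way round.\<close>
  define g where "g = Comp ts [Comp pair_rf [Proj 2, Comp pair_rf [Proj 1, Proj 0]]]"
  have step: "eval A g [enc r, k, enc x] (enc (s x k r))" for r k x
    unfolding g_def
  proof (rule eval_comp1)
    show "eval A (Comp pair_rf [Proj 2, Comp pair_rf [Proj 1, Proj 0]]) [enc r, k, enc x]
            (enc (x, (k, r)))"
      by (rule eval_basic eval_pair_rf | simp add: enc_Pair)+
    show "eval A ts [enc (x, (k, r))] (enc (s x k r))" using t(1)[of "(x, (k, r))"] by simp
  qed
  have *: "eval A (Prim tz g) [k, enc x] (enc (rec_nat (z x) (s x) k))" for k x
  proof (induction k)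
    case 0
    then show ?case using t(2) ev_prim0 by simp
  next
    case (Suc k)
    show ?case using ev_primS[OF Suc step] by simp
  qed
  show ?thesis
    by (rule computableI[of _ "Comp (Prim tz g) [tn, Proj 0]"], rule eval_comp2)
      (rule t(3)[unfolded enc_nat_def] * eval_Proj | simp)+
qed

lemma computable_of_bool [comp_intros]:
  "computable A f \<Longrightarrow> computable A (\<lambda>x. of_bool (f x) :: nat)"
  by (erule computable_cong_enc) simp

lemma computable_If [comp_intros]:
  assumes "computable A b" "computable A f" "computable A g"
  shows "computable A (\<lambda>x. if b x then f x else g x)"
proof -
  have "(if b x then f x else g x) = rec_nat (g x) (\<lambda>_ _. f x) (of_bool (b x))" for x by simp
  then show ?thesis by (simp only:) (intro comp_intros assms computable_comp[OF assms(2)])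
qed

lemma computable_Not [comp_intros]:
  assumes "computable A f"
  shows "computable A (\<lambda>x. \<not> f x)"
proof -
  have *: "(\<not> b) = (if b then False else True)" for b by simp
  show ?thesis unfolding * by (intro comp_intros assms)
qed

lemma computable_conj [comp_intros]:
  assumes "computable A f" "computable A g"
  shows "computable A (\<lambda>x. f x \<and> g x)"
proof -
  have *: "(b \<and> c) = (if b then c else False)" for b c by simp
  show ?thesis unfolding * by (intro comp_intros assms)
qed

lemma computable_disj [comp_intros]:
  assumes "computable A f" "computable A g"
  shows "computable A (\<lambda>x. f x \<or> g x)"
proof -
  have *: "(b \<or> c) = (if b then True else c)" for b c by simp
  show ?thesis unfolding * by (intro comp_intros assms)
qed

lemma computable_add [comp_intros]:
  fixes f g :: "'a::coded \<Rightarrow> nat"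
  assumes "computable A f" "computable A g"
  shows "computable A (\<lambda>x. f x + g x)"
proof -
  have *: "m + n = rec_nat n (\<lambda>_ r. Suc r) m" for m n by (induction m) auto
  show ?thesis unfolding * by (intro comp_intros assms)
qed

lemma computable_mult [comp_intros]:
  fixes f g :: "'a::coded \<Rightarrow> nat"
  assumes "computable A f" "computable A g"
  shows "computable A (\<lambda>x. f x * g x)"
proof -
  have *: "m * n = rec_nat 0 (\<lambda>_ r. n + r) m" for m n by (induction m) auto
  show ?thesis unfolding * by (intro comp_intros assms computable_comp[OF assms(2)])
qed

lemma computable_diff [comp_intros]:
  fixes f g :: "'a::coded \<Rightarrow> nat"
  assumes "computable A f" "computable A g"
  shows "computable A (\<lambda>x. f x - g x)"
proof -
  have pred: "rec_nat 0 (\<lambda>n _. n) m = m - Suc 0" for m by (cases m) auto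
  have *: "m - n = rec_nat m (\<lambda>_ r. rec_nat 0 (\<lambda>n _. n) r) n" for m n
    by (induction n) (auto simp: pred)
  show ?thesis unfolding * by (intro comp_intros assms)
qed

lemma computable_eq_0:
  fixes f :: "'a::coded \<Rightarrow> nat"
  assumes "computable A f"
  shows "computable A (\<lambda>x. f x = 0)"
proof -
  have *: "(m = 0) = rec_nat True (\<lambda>_ _. False) m" for m :: nat by (cases m) auto
  show ?thesis unfolding * by (intro comp_intros assms)
qed

lemma computable_le [comp_intros]:
  fixes f g :: "'a::coded \<Rightarrow> nat"
  shows "computable A f \<Longrightarrow> computable A g \<Longrightarrow> computable A (\<lambda>x. f x \<le> g x)"
  using computable_eq_0[OF computable_diff, of A f g] by simp

lemma computable_less [comp_intros]:
  fixes f g :: "'a::coded \<Rightarrow> nat"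
  shows "computable A f \<Longrightarrow> computable A g \<Longrightarrow> computable A (\<lambda>x. f x < g x)"
  using computable_le[OF computable_Suc, of A f g] by (simp add: Suc_le_eq)

lemma computable_enc [comp_intros]: "computable A f \<Longrightarrow> computable A (\<lambda>x. enc (f x))"
  by (erule computable_cong_enc) simp

lemma computable_eq [comp_intros]:
  assumes "computable A f" "computable A g"
  shows "computable A (\<lambda>x. f x = g x)"
proof -
  have *: "a = b \<longleftrightarrow> enc a \<le> enc b \<and> enc b \<le> enc a" for a b :: 'b
    by (metis enc_inject order_antisym order_refl)
  show ?thesis unfolding * by (intro comp_intros assms)
qed

lemma computable_prod_decode [comp_intros]:
  "computable A f \<Longrightarrow> computable A (\<lambda>x. prod_decode (f x))"
  by (erule computable_cong_enc) (simp add: enc_prod_decode)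

lemma computable_prod_encode [comp_intros]:
  "computable A f \<Longrightarrow> computable A (\<lambda>x. prod_encode (f x))"
  by (erule computable_cong_enc) (simp add: enc_prod_def)

lemma computable_list_decode [comp_intros]:
  "computable A f \<Longrightarrow> computable A (\<lambda>x. list_decode (f x))"
  by (erule computable_cong_enc) (simp add: enc_list_decode)

lemma computable_case_prod [comp_intros]:
  assumes "computable A (\<lambda>q. f (fst q) (fst (snd q)) (snd (snd q)))" "computable A p"
  shows "computable A (\<lambda>x. case_prod (f x) (p x))"
  using computable_comp[OF assms(1) computable_Pair[OF computable_id assms(2)]]
  by (simp add: case_prod_beta)

lemma computable_Let [comp_intros]:
  assumes "computable A (\<lambda>q. f (fst q) (snd q))" "computable A v"
  shows "computable A (\<lambda>x. Let (v x) (f x))"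
  using computable_comp[OF assms(1) computable_Pair[OF computable_id assms(2)]]
  by (simp add: Let_def)

lemma computable_Least [comp_intros]:
  fixes P :: "'a::coded \<Rightarrow> nat \<Rightarrow> bool"
  assumes "computable A (\<lambda>p. P (fst p) (snd p))" and ex: "\<And>x. \<exists>k. P x k"
  shows "computable A (\<lambda>x. LEAST k. P x k)"
proof -
  have "computable A (\<lambda>p. of_bool (\<not> P (fst p) (snd p)) :: nat)" by (intro comp_intros assms)
  then obtain t where t: "\<And>p. eval A t [enc p] (of_bool (\<not> P (fst p) (snd p)))"
    unfolding computable_def enc_nat_def by blast
  show ?thesis
  proof (rule computableI)
    fix x
    have "eval A (Mn (Comp t [Comp pair_rf [Proj 1, Proj 0]])) [enc x]
            (LEAST k. (of_bool (\<not> P x k) :: nat) = 0)"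
    proof (rule eval_Mn)
      fix k
      show "eval A (Comp t [Comp pair_rf [Proj 1, Proj 0]]) [k, enc x] (of_bool (\<not> P x k))"
      proof (rule eval_comp1)
        show "eval A (Comp pair_rf [Proj 1, Proj 0]) [k, enc x] (enc (x, k))"
          by (rule eval_basic eval_pair_rf | simp add: enc_Pair)+
        show "eval A t [enc (x, k)] (of_bool (\<not> P x k))" using t[of "(x, k)"] by simp
      qed
    qed (use ex[of x] in simp)
    then show "eval A (Mn (Comp t [Comp pair_rf [Proj 1, Proj 0]])) [enc x] (enc (LEAST k. P x k))"
      by simp
  qed
qed

subsection \<open>Lists\<close>

lemma computable_Cons [comp_intros]:
  assumes "computable A f" "computable A g"
  shows "computable A (\<lambda>x. f x # g x)"
proof (rule computable_cong_enc)
  show "computable A (\<lambda>x. Suc (prod_encode (enc (f x), enc (g x))))"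
    by (intro comp_intros assms)
qed (simp add: enc_Cons)

lemma prod_decode_0: "prod_decode 0 = (0, 0)"
  using prod_encode_inverse[of "(0, 0)"] by (simp add: prod_encode_def)

lemma computable_tl [comp_intros]:
  assumes "computable A f"
  shows "computable A (\<lambda>x. tl (f x))"
proof -
  have *: "enc (tl xs) = enc (snd (prod_decode (enc xs - 1)))" for xs :: "'b list"
    by (cases xs) (simp_all add: enc_Cons prod_decode_0)
  show ?thesis
    by (rule computable_cong_enc[OF _ *]) (intro comp_intros assms)
qed

text \<open>\<open>hd []\<close> is unspecified but a fixed element, so its code is a
  constant.\<close>

lemma computable_hd [comp_intros]:
  assumes "computable A f"
  shows "computable A (\<lambda>x. hd (f x))"
proof -
  have *: "enc (hd xs) =
      enc (if enc xs = 0 then enc (hd [] :: 'b) else fst (prod_decode (enc xs - 1)))"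
    for xs :: "'b list" by (cases xs) (simp_all add: enc_Cons)
  show ?thesis
    by (rule computable_cong_enc[OF _ *]) (intro comp_intros assms)
qed

text \<open>The code of the list serves as fuel: it is at least the length, and a step leaves the
  state alone once the list has been consumed.\<close>

lemma computable_foldl [comp_intros]:
  assumes "computable A (\<lambda>p. f (fst p) (fst (snd p)) (snd (snd p)))"
    and "computable A a" "computable A l"
  shows "computable A (\<lambda>x. foldl (f x) (a x) (l x))"
proof -
  define step where "step x st = (if fst st = [] then st
    else (tl (fst st), f x (snd st) (hd (fst st))))" for x st
  have rec: "length xs \<le> n \<Longrightarrow> rec_nat (xs, b) (\<lambda>_. step x) n = ([], foldl (f x) b xs)" for x xs b n
  proof (induction xs arbitrary: b n)
    case Nil
    show ?case by (induction n) (simp_all add: step_def)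
  next
    case (Cons y ys)
    then obtain m where m: "n = Suc m" "length ys \<le> m" by (cases n) auto
    have step: "step x (y # ys, b) = (ys, f x b y)" by (simp add: step_def)
    have "rec_nat (y # ys, b) (\<lambda>_. step x) (Suc m) = rec_nat (step x (y # ys, b)) (\<lambda>_. step x) m"
      by (induction m) simp_all
    then show ?case by (simp only: m(1) step Cons.IH[OF m(2)] foldl.simps)
  qed
  have "computable A (\<lambda>x. snd (rec_nat (l x, a x) (\<lambda>_. step x) (enc (l x))))"
    unfolding step_def by (intro comp_intros assms computable_comp3[OF assms(1)])
  then show ?thesis by (simp add: rec length_le_enc)
qed

lemma computable_rev [comp_intros]:
  assumes "computable A l"
  shows "computable A (\<lambda>x. rev (l x))"
proof -
  have *: "rev xs = foldl (\<lambda>r x. x # r) [] xs" for xs :: "'b list"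
    by (simp add: foldl_conv_fold rev_conv_fold)
  show ?thesis unfolding * by (intro comp_intros assms)
qed

text \<open>The recursion runs from the end of the list, hence the reversal; the first component of
  the state rebuilds the tail that the step function receives.\<close>

lemma computable_rec_list [comp_intros]:
  assumes "computable A (\<lambda>p. s (fst p) (fst (snd p)) (fst (snd (snd p))) (snd (snd (snd p))))"
    and "computable A z" "computable A l"
  shows "computable A (\<lambda>x. rec_list (z x) (s x) (l x))"
proof -
  have *: "foldl (\<lambda>st y. (y # fst st, s x y (fst st) (snd st))) ([], b) (rev xs) =
      (xs, rec_list b (s x) xs)" for x b xs
    by (induction xs) simp_all
  have "computable A (\<lambda>x. snd (foldl (\<lambda>st y. (y # fst st, s x y (fst st) (snd st)))
      ([], z x) (rev (l x))))"
    by (intro comp_intros assms computable_comp4[OF assms(1)])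
  then show ?thesis by (simp add: *)
qed

lemma computable_append [comp_intros]:
  assumes "computable A f" "computable A g"
  shows "computable A (\<lambda>x. f x @ g x)"
proof -
  have *: "xs @ ys = rec_list ys (\<lambda>x _ r. x # r) xs" for xs ys :: "'b list"
    by (induction xs) simp_all
  show ?thesis unfolding * by (intro comp_intros assms)
qed

lemma computable_length [comp_intros]:
  assumes "computable A f"
  shows "computable A (\<lambda>x. length (f x))"
proof -
  have *: "length xs = rec_list 0 (\<lambda>x _ r. Suc r) xs" for xs :: "'b list"
    by (induction xs) simp_all
  show ?thesis unfolding * by (intro comp_intros assms)
qed

lemma computable_map [comp_intros]:
  assumes "computable A (\<lambda>p. f (fst p) (snd p))" "computable A l"
  shows "computable A (\<lambda>x. map (f x) (l x))"
proof -
  have *: "map h xs = rec_list [] (\<lambda>x _ r. h x # r) xs" for h xs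
    by (induction xs) simp_all
  show ?thesis unfolding * by (intro comp_intros assms computable_comp2[OF assms(1)])
qed

lemma computable_filter [comp_intros]:
  assumes "computable A (\<lambda>p. P (fst p) (snd p))" "computable A l"
  shows "computable A (\<lambda>x. filter (P x) (l x))"
proof -
  have *: "filter Q xs = rec_list [] (\<lambda>x _ r. if Q x then x # r else r) xs" for Q xs
    by (induction xs) simp_all
  show ?thesis unfolding * by (intro comp_intros assms computable_comp2[OF assms(1)])
qed

lemma computable_ball_set [comp_intros]:
  assumes "computable A (\<lambda>p. P (fst p) (snd p))" "computable A l"
  shows "computable A (\<lambda>x. \<forall>y\<in>set (l x). P x y)"
proof -
  have *: "(\<forall>y\<in>set xs. Q y) = rec_list True (\<lambda>x _ r. Q x \<and> r) xs" for Q xs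
    by (induction xs) simp_all
  show ?thesis unfolding * by (intro comp_intros assms computable_comp2[OF assms(1)])
qed

lemma computable_member [comp_intros]:
  assumes "computable A f" "computable A l"
  shows "computable A (\<lambda>x. f x \<in> set (l x))"
proof -
  have *: "y \<in> set xs \<longleftrightarrow> \<not> (\<forall>z\<in>set xs. z \<noteq> y)" for y :: 'b and xs by auto
  show ?thesis
    unfolding * by (intro comp_intros assms computable_comp[OF assms(1)])
qed

lemma computable_upt [comp_intros]:
  assumes "computable A f"
  shows "computable A (\<lambda>x. [0..<f x])"
proof -
  have *: "[0..<n] = rec_nat [] (\<lambda>k r. r @ [k]) n" for n by (induction n) simp_all
  show ?thesis unfolding * by (intro comp_intros assms)
qed

lemma computable_ball_less [comp_intros]:
  fixes P :: "'a::coded \<Rightarrow> nat \<Rightarrow> bool"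
  assumes "computable A (\<lambda>p. P (fst p) (snd p))" "computable A n"
  shows "computable A (\<lambda>x. \<forall>k<n x. P x k)"
proof -
  have *: "(\<forall>k<m. Q k) \<longleftrightarrow> (\<forall>k\<in>set [0..<m]. Q k)" for m :: nat and Q by auto
  show ?thesis unfolding * by (intro comp_intros assms)
qed

lemma computable_replicate [comp_intros]:
  assumes "computable A n" "computable A f"
  shows "computable A (\<lambda>x. replicate (n x) (f x))"
proof -
  have *: "replicate m y = rec_nat [] (\<lambda>_ r. y # r) m" for m and y :: 'b by (induction m) simp_all
  show ?thesis
    unfolding * by (intro comp_intros assms computable_comp[OF assms(2)])
qed

lemma computable_drop [comp_intros]:
  assumes "computable A n" "computable A l"
  shows "computable A (\<lambda>x. drop (n x) (l x))"
proof -
  have *: "drop m xs = rec_nat xs (\<lambda>_. tl) m" for m and xs :: "'b list"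
    by (induction m) (simp_all add: drop_Suc flip: tl_drop)
  show ?thesis unfolding * by (intro comp_intros assms)
qed

text \<open>Out of range, \<open>xs ! i\<close> is an unspecified value that may vary with
  \<open>i\<close>; computability calls for an explicit default.\<close>

definition nthd :: "'a \<Rightarrow> 'a list \<Rightarrow> nat \<Rightarrow> 'a" where
  "nthd d xs i = (if i < length xs then xs ! i else d)"

lemma computable_nthd [comp_intros]:
  assumes "computable A d" "computable A l" "computable A n"
  shows "computable A (\<lambda>x. nthd (d x) (l x) (n x))"
proof -
  have *: "nthd c xs m = (if m < length xs then hd (drop m xs) else c)" for m xs c
    by (simp add: nthd_def hd_drop_conv_nth)
  show ?thesis unfolding * by (intro comp_intros assms)
qed

lemma computable_div [comp_intros]:
  fixes f g :: "'a::coded \<Rightarrow> nat"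
  assumes "computable A f" "computable A g"
  shows "computable A (\<lambda>x. f x div g x)"
proof -
  \<comment> \<open>The disjunct \<open>k = 0\<close> lets the search end for a zero divisor, with
    the value 0 that \<open>div\<close> has there.\<close>
  have bound: "\<exists>q. k = 0 \<or> n < k * Suc q" for n k :: nat
    by (rule exI[of _ n]) (cases k, auto)
  have *: "n div k = (LEAST q. k = 0 \<or> n < k * Suc q)" for n k :: nat
  proof (cases "k = 0")
    case False
    show ?thesis
    proof (rule Least_equality[symmetric])
      show "k = 0 \<or> n < k * Suc (n div k)" using False by (simp add: dividend_less_times_div)
      show "n div k \<le> q" if "k = 0 \<or> n < k * Suc q" for q
        using that False by (metis div_less_iff_less_mult less_Suc_eq_le mult.commute neq0_conv)
    qed
  qed simp
  show ?thesis unfolding *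
    by (intro comp_intros assms bound computable_comp[OF assms(1)] computable_comp[OF assms(2)])
qed

lemma computable_mod [comp_intros]:
  fixes f g :: "'a::coded \<Rightarrow> nat"
  assumes "computable A f" "computable A g"
  shows "computable A (\<lambda>x. f x mod g x)"
  unfolding minus_mult_div_eq_mod[symmetric] by (intro comp_intros assms)

section \<open>A step-bounded universal machine\<close>

lemma prod_decode_le:
  "fst (prod_decode n) \<le> n" "snd (prod_decode n) \<le> n"
  using le_prod_encode_1[of "fst (prod_decode n)" "snd (prod_decode n)"]
    le_prod_encode_2[of "snd (prod_decode n)" "fst (prod_decode n)"] by simp_all

text \<open>Every recursive call goes to a smaller code, because dividing by 7 or subtracting 1
  decreases a positive number and the components of a pair are at most its code. So any fuel above
  the code has the same effect.\<close>

lemma dec_fuel: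
  "n < k \<Longrightarrow> n < k' \<Longrightarrow> dec k n = dec k' n"
  "n < k \<Longrightarrow> n < k' \<Longrightarrow> decl k n = decl k' n"
proof (induction k arbitrary: k' n)
  case (Suc k)
  {
    case 1
    then obtain j where j: "k' = Suc j" by (cases k') auto
    have *: "m < k \<and> m < j" if "n mod 7 \<noteq> 0" "m \<le> n div 7" for m
    proof -
      have "n div 7 < n" using that(1) by (cases n) auto
      then show ?thesis using that(2) 1 j by simp
    qed
    have "dec k (n div 7) = dec j (n div 7)"
      "dec k (fst (prod_decode (n div 7))) = dec j (fst (prod_decode (n div 7)))"
      "dec k (snd (prod_decode (n div 7))) = dec j (snd (prod_decode (n div 7)))"
      "decl k (snd (prod_decode (n div 7))) = decl j (snd (prod_decode (n div 7)))"
      if "n mod 7 \<noteq> 0"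
      using *[OF that] prod_decode_le[of "n div 7"] by (auto intro!: Suc.IH)
    note eqs = this
    show ?case
    proof (cases "n mod 7 = 0")
      case False
      show ?thesis unfolding j dec.simps Let_def eqs[OF False] ..
    qed (simp add: j)
  next
    case 2
    then obtain j where j: "k' = Suc j" by (cases k') auto
    show ?case
    proof (cases "n = 0")
      case False
      then have "n - 1 < k" "n - 1 < j" using 2 j by auto
      then have "fst (prod_decode (n - 1)) < k" "fst (prod_decode (n - 1)) < j"
        "snd (prod_decode (n - 1)) < k" "snd (prod_decode (n - 1)) < j"
        using prod_decode_le[of "n - 1"] by linarith+
      then have "dec k (fst (prod_decode (n - 1))) = dec j (fst (prod_decode (n - 1)))"
        "decl k (snd (prod_decode (n - 1))) = decl j (snd (prod_decode (n - 1)))"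
        by (auto intro!: Suc.IH)
      then show ?thesis unfolding j decl.simps by (simp only:)
    qed (simp add: j)
  }
qed simp_all

lemma dec_eq_decode: "n < k \<Longrightarrow> dec k n = decode n"
  unfolding decode_def by (rule dec_fuel) simp_all

lemma decl_eq_map_decode: "n < k \<Longrightarrow> decl k n = map decode (list_decode n)"
proof (induction k arbitrary: n)
  case (Suc k)
  show ?case
  proof (cases n)
    case (Suc m)
    then have "fst (prod_decode m) < k" "snd (prod_decode m) < k"
      using Suc.prems prod_decode_le[of m] by auto
    then show ?thesis using Suc Suc.IH dec_eq_decode by (simp add: case_prod_beta)
  qed simp
qed simp

lemma decode_unfold:
  "decode n = (let c = n mod 7; m = n div 7; a = fst (prod_decode m); b = snd (prod_decode m) in
     if c = 0 then Zero else if c = 1 then Succ else if c = 2 then Proj m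
     else if c = 3 then Oracle
     else if c = 4 then Comp (decode a) (map decode (list_decode b))
     else if c = 5 then Prim (decode a) (decode b)
     else Mn (decode m))"
proof (cases "n mod 7 = 0")
  case False
  then have "n div 7 < n" by (cases n) auto
  then have "n div 7 < n" "fst (prod_decode (n div 7)) < n" "snd (prod_decode (n div 7)) < n"
    using prod_decode_le[of "n div 7"] by linarith+
  then show ?thesis
    by (subst decode_def) (simp add: Let_def dec_eq_decode decl_eq_map_decode)
qed (simp add: decode_def)

lemma decode_surj: "\<exists>e. decode e = p"
proof -
  have *: "\<exists>e. e mod 7 = c \<and> e div 7 = m" if "c \<in> {0, 1, 2, 3, 4, 5, 6}" for c m :: nat
    using that by (intro exI[of _ "c + 7 * m"]) auto
  show ?thesis
  proof (induction p)
    case Zero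
    obtain e :: nat where "e mod 7 = 0" "e div 7 = 0" using *[of 0 0] by auto
    then have "decode e = Zero" by (subst decode_unfold) (simp add: Let_def)
    then show ?case ..
  next
    case Succ
    obtain e :: nat where "e mod 7 = 1" "e div 7 = 0" using *[of 1 0] by auto
    then have "decode e = Succ" by (subst decode_unfold) (simp add: Let_def)
    then show ?case ..
  next
    case (Proj i)
    obtain e :: nat where "e mod 7 = 2" "e div 7 = i" using *[of 2 i] by auto
    then have "decode e = Proj i" by (subst decode_unfold) (simp add: Let_def)
    then show ?case ..
  next
    case Oracle
    obtain e :: nat where "e mod 7 = 3" "e div 7 = 0" using *[of 3 0] by auto
    then have "decode e = Oracle" by (subst decode_unfold) (simp add: Let_def)
    then show ?case ..
  next
    case (Comp f gs)
    then obtain a where "decode a = f" by auto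
    moreover obtain bs where "gs = map decode bs" using Comp(2) ex_map_conv[of gs decode] by metis
    moreover obtain e :: nat where "e mod 7 = 4" "e div 7 = prod_encode (a, list_encode bs)"
      using *[of 4] by auto
    ultimately have "decode e = Comp f gs" by (subst decode_unfold) (simp add: Let_def)
    then show ?case ..
  next
    case (Prim f g)
    then obtain a b where "decode a = f" "decode b = g" by auto
    moreover obtain e :: nat where "e mod 7 = 5" "e div 7 = prod_encode (a, b)"
      using *[of 5] by auto
    ultimately have "decode e = Prim f g" by (subst decode_unfold) (simp add: Let_def)
    then show ?case ..
  next
    case (Mn f)
    then obtain a where "decode a = f" by auto
    moreover obtain e :: nat where "e mod 7 = 6" "e div 7 = a"
      using *[of 6] by auto
    ultimately have "decode e = Mn f" by (subst decode_unfold) (simp add: Let_def)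
    then show ?case ..
  qed
qed

section \<open>Finite derivations with a string as oracle\<close>

type_synonym fact = "nat \<times> nat list \<times> nat"

text \<open>The list \<open>ws\<close> holds the intermediate values that the evaluation rule needs.\<close>

definition justified :: "bool list \<Rightarrow> fact list \<Rightarrow> nat \<Rightarrow> nat list \<Rightarrow> nat \<Rightarrow> nat list \<Rightarrow> bool" where
  "justified \<tau> L e xs y ws \<longleftrightarrow>
     (let c = e mod 7; m = e div 7; a = fst (prod_decode m); b = snd (prod_decode m) in
      if c = 0 then y = 0
      else if c = 1 then y = Suc (nthd 0 xs 0)
      else if c = 2 then y = nthd 0 xs m
      else if c = 3 then nthd 0 xs 0 < length \<tau> \<and> y = of_bool (nthd False \<tau> (nthd 0 xs 0))
      else if c = 4 then length ws = length (list_decode b) \<and>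
        (\<forall>i<length ws. (nthd 0 (list_decode b) i, xs, nthd 0 ws i) \<in> set L) \<and> (a, ws, y) \<in> set L
      else if c = 5 then xs \<noteq> [] \<and>
        (if hd xs = 0 then (a, tl xs, y) \<in> set L
         else (e, (hd xs - 1) # tl xs, hd ws) \<in> set L \<and>
              (b, hd ws # (hd xs - 1) # tl xs, y) \<in> set L)
      else (m, y # xs, 0) \<in> set L \<and>
        (\<forall>i<y. nthd 0 ws i \<noteq> 0 \<and> (m, i # xs, nthd 0 ws i) \<in> set L))"
definition candidate :: "nat \<Rightarrow> nat \<times> nat list \<times> nat \<times> nat list" where
  "candidate c = (let p = prod_decode c; q = prod_decode (snd p); r = prod_decode (snd q) in
     (fst p, list_decode (fst q), fst r, list_decode (snd r)))"

lemma candidate_surj: "\<exists>c. candidate c = (e, xs, y, ws)"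
  by (rule exI[of _ "prod_encode (e, prod_encode (list_encode xs, prod_encode (y, list_encode ws)))"])
    (simp add: candidate_def Let_def)

text \<open>Using only the first component of \<open>prod_decode k\<close> makes each candidate come
  up infinitely often, so that it is tried again after the facts it rests on have been
  listed.\<close>

primrec facts :: "bool list \<Rightarrow> nat \<Rightarrow> fact list" where
  "facts \<tau> 0 = []"
| "facts \<tau> (Suc k) = (case candidate (fst (prod_decode k)) of (e, xs, y, ws) \<Rightarrow>
     if justified \<tau> (facts \<tau> k) e xs y ws then (e, xs, y) # facts \<tau> k else facts \<tau> k)"

text \<open>The value \<open>0\<close> means that no computation has been found within \<open>s\<close> steps.\<close>

definition ev :: "bool list \<Rightarrow> nat \<Rightarrow> nat \<Rightarrow> nat list \<Rightarrow> nat" where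
  "ev \<tau> s e xs = (let L = filter (\<lambda>f. fst f = e \<and> fst (snd f) = xs) (facts \<tau> s) in
     if L = [] then 0 else Suc (snd (snd (hd L))))"

lemma nthd_append: "i < length xs \<Longrightarrow> nthd d (xs @ ys) i = nthd d xs i"
  by (simp add: nthd_def nth_append)

text \<open>A query beyond the end of the string justifies nothing, so prolonging the string cannot
  alter an answer already used.\<close>

lemma justified_mono:
  assumes j: "justified \<tau> L e xs y ws" and L: "set L \<subseteq> set L'"
  shows "justified (\<tau> @ u) L' e xs y ws"
proof -
  consider "e mod 7 = 0" | "e mod 7 = 1" | "e mod 7 = 2" | "e mod 7 = 3" | "e mod 7 = 4"
    | "e mod 7 = 5" | "e mod 7 = 6" by linarith
  then show ?thesis
  proof cases
    case 4
    then show ?thesis using j by (auto simp: justified_def Let_def nthd_append)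
  next
    case 6
    then show ?thesis using j L by (cases "hd xs = 0") (auto simp: justified_def Let_def)
  qed (use j L in \<open>auto simp: justified_def Let_def\<close>)
qed

lemma facts_mono_aux: "set (facts \<tau> s) \<subseteq> set (facts (\<tau> @ u) s)"
proof (induction s)
  case (Suc s)
  obtain e xs y ws where "candidate (fst (prod_decode s)) = (e, xs, y, ws)"
    by (metis prod_cases4)
  then show ?case using Suc justified_mono[OF _ Suc] by auto
qed simp

lemma facts_Suc_subset: "set (facts \<tau> s) \<subseteq> set (facts \<tau> (Suc s))"
proof -
  obtain e xs y ws where "candidate (fst (prod_decode s)) = (e, xs, y, ws)"
    by (metis prod_cases4)
  then show ?thesis by auto
qed

lemma facts_mono:
  assumes "s \<le> s'"
  shows "set (facts \<tau> s) \<subseteq> set (facts (\<tau> @ u) s')"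
proof -
  have "set (facts \<tau> s) \<subseteq> set (facts \<tau> s')"
    using assms by (induction rule: dec_induct) (use facts_Suc_subset in blast)+
  then show ?thesis using facts_mono_aux by blast
qed

section \<open>Soundness and completeness of the derivations\<close>

definition agrees :: "bool list \<Rightarrow> nat set \<Rightarrow> bool" where
  "agrees \<tau> A \<longleftrightarrow> (\<forall>i<length \<tau>. \<tau> ! i \<longleftrightarrow> i \<in> A)"

lemma justified_eval:
  assumes j: "justified \<tau> L e xs y ws" and \<tau>: "agrees \<tau> A"
    and L: "\<And>e xs y. (e, xs, y) \<in> set L \<Longrightarrow> eval A (decode e) xs y"
  shows "eval A (decode e) xs y"
proof -
  define c m a b where d: "c = e mod 7" "m = e div 7"
    "a = fst (prod_decode m)" "b = snd (prod_decode m)"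
  note j = j[unfolded justified_def Let_def, folded d]
  note dec = decode_unfold[of e, unfolded Let_def, folded d]
  consider "c = 0" | "c = 1" | "c = 2" | "c = 3" | "c = 4" | "c = 5" | "c = 6"
    using d(1) by linarith
  then show ?thesis
  proof cases
    case 1
    then show ?thesis using j dec by (simp add: ev_zero)
  next
    case 2
    have "nthd 0 xs 0 = arg0 xs" by (simp add: nthd_def arg0_def nth_Cons' split: list.split)
    then show ?thesis using 2 j dec ev_succ[of A xs] by simp
  next
    case 3
    then show ?thesis using j dec ev_proj[of A m xs] by (simp add: nthd_def)
  next
    case 4
    have "nthd 0 xs 0 = arg0 xs" by (simp add: nthd_def arg0_def nth_Cons' split: list.split)
    then show ?thesis using 4 j dec ev_oracle[of A xs] \<tau>
      by (auto simp: nthd_def[of False] agrees_def split: if_splits)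
  next
    case 5
    then have j': "length ws = length (list_decode b)"
      "\<forall>i<length ws. (nthd 0 (list_decode b) i, xs, nthd 0 ws i) \<in> set L" "(a, ws, y) \<in> set L"
      using j by auto
    have "eval A (Comp (decode a) (map decode (list_decode b))) xs y"
    proof (rule ev_comp)
      show "list_all2 (\<lambda>g y. eval A g xs y) (map decode (list_decode b)) ws"
        using j'(1,2) L by (auto simp: list_all2_conv_all_nth nthd_def)
    qed (rule L[OF j'(3)])
    then show ?thesis using 5 dec by simp
  next
    case 6
    then have dec: "decode e = Prim (decode a) (decode b)" using dec by simp
    from 6 j obtain x xs' where xs: "xs = x # xs'" by (cases xs) auto
    show ?thesis
    proof (cases x)
      case 0
      then show ?thesis using 6 j xs dec L ev_prim0 by simp
    next
      case (Suc n)
      then have "(e, n # xs', hd ws) \<in> set L" "(b, hd ws # n # xs', y) \<in> set L"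
        using 6 j xs by auto
      then show ?thesis unfolding dec xs Suc using L dec by (metis ev_primS)
    qed
  next
    case 7
    then have "eval A (Mn (decode m)) xs y" using j L by (intro ev_mn) auto
    then show ?thesis using 7 dec by simp
  qed
qed

lemma facts_sound:
  "agrees \<tau> A \<Longrightarrow> (e, xs, y) \<in> set (facts \<tau> s) \<Longrightarrow> eval A (decode e) xs y"
proof (induction s arbitrary: e xs y)
  case (Suc s)
  obtain e' xs' y' ws where "candidate (fst (prod_decode s)) = (e', xs', y', ws)"
    by (metis prod_cases4)
  then have "(e, xs, y) \<in> set (facts \<tau> s) \<or> justified \<tau> (facts \<tau> s) e xs y ws"
    using Suc.prems(2) by (auto split: if_splits)
  then show ?case using Suc justified_eval by metis
qed simp

text \<open>Every string agrees with some set, and evaluation relative to that set is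
  deterministic.\<close>

lemma facts_fun:
  assumes "(e, xs, y) \<in> set (facts \<tau> s)" "(e, xs, z) \<in> set (facts \<tau> s')"
  shows "y = z"
proof -
  have "agrees \<tau> {i. i < length \<tau> \<and> \<tau> ! i}" by (auto simp: agrees_def)
  then show ?thesis using assms facts_sound eval_det by metis
qed

lemma ev_eq_Suc: "ev \<tau> s e xs = Suc y \<longleftrightarrow> (e, xs, y) \<in> set (facts \<tau> s)"
proof -
  let ?L = "filter (\<lambda>f. fst f = e \<and> fst (snd f) = xs) (facts \<tau> s)"
  show ?thesis
  proof (cases "?L = []")
    case True
    then show ?thesis by (auto simp: ev_def filter_empty_conv)
  next
    case False
    then have "hd ?L \<in> set ?L" by (rule hd_in_set)
    moreover obtain e' xs' z where h: "hd ?L = (e', xs', z)" by (rule prod_cases3)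
    ultimately have z: "hd ?L = (e, xs, z)" "(e, xs, z) \<in> set (facts \<tau> s)" by auto
    then have "ev \<tau> s e xs = Suc z" using False by (simp add: ev_def)
    then show ?thesis using z(2) facts_fun by auto
  qed
qed

lemma ev_mono:
  assumes "ev \<tau> s e xs \<noteq> 0" "s \<le> s'"
  shows "ev (\<tau> @ u) s' e xs = ev \<tau> s e xs"
proof -
  obtain y where y: "ev \<tau> s e xs = Suc y" using assms(1) not0_implies_Suc by blast
  then have "ev (\<tau> @ u) s' e xs = Suc y" using facts_mono[OF assms(2), of \<tau> u] unfolding ev_eq_Suc by blast
  then show ?thesis using y by simp
qed

lemma ev_sound: "agrees \<tau> A \<Longrightarrow> ev \<tau> s e xs = Suc y \<Longrightarrow> eval A (decode e) xs y"
  unfolding ev_eq_Suc by (rule facts_sound)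

definition segment :: "nat set \<Rightarrow> nat \<Rightarrow> bool list" where
  "segment A n = map (\<lambda>i. i \<in> A) [0..<n]"

lemma segment_append:
  assumes "m \<le> n"
  shows "\<exists>u. segment A n = segment A m @ u"
proof -
  obtain k where "n = m + k" using assms le_Suc_ex by blast
  then show ?thesis
    unfolding segment_def using upt_add_eq_append[of 0 m k] by simp
qed

lemma facts_segment_mono:
  "m \<le> n \<Longrightarrow> set (facts (segment A m) m) \<subseteq> set (facts (segment A n) n)"
  using facts_mono segment_append by metis

lemma justified_eventually:
  assumes "\<forall>\<^sub>F n in sequentially. justified (segment A n) (facts (segment A n) n) e xs y ws"
  shows "\<forall>\<^sub>F n in sequentially. (e, xs, y) \<in> set (facts (segment A n) n)"
proof -
  from assms obtain N where N: "\<And>n. n \<ge> N \<Longrightarrow> justified (segment A n) (facts (segment A n) n) e xs y ws"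
    by (auto simp: eventually_sequentially)
  obtain c where c: "candidate c = (e, xs, y, ws)" using candidate_surj by blast
  \<comment> \<open>Step \<open>k\<close> tries candidate \<open>c\<close> and comes no earlier than
    \<open>N\<close>, when its justification is in place.\<close>
  define k where "k = prod_encode (c, N)"
  have "N \<le> k" by (simp add: k_def le_prod_encode_2)
  then have "(e, xs, y) \<in> set (facts (segment A k) (Suc k))"
    using N[of k] c by (simp add: k_def)
  moreover obtain u where "segment A (Suc k) = segment A k @ u" using segment_append[of k "Suc k"] by auto
  ultimately have "(e, xs, y) \<in> set (facts (segment A (Suc k)) (Suc k))"
    using facts_mono[OF order_refl] by (metis subsetD)
  then show ?thesis
    unfolding eventually_sequentially using facts_segment_mono by blast
qed

lemma facts_complete:
  "eval A p xs y \<Longrightarrow> decode e = p \<Longrightarrow>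
    \<forall>\<^sub>F n in sequentially. (e, xs, y) \<in> set (facts (segment A n) n)"
proof (induction arbitrary: e rule: eval.induct)
  case (ev_zero xs)
  then have "e mod 7 = 0" unfolding decode_unfold[of e] Let_def by (simp split: if_splits)
  then show ?case by (intro justified_eventually[where ws = "[]"]) (simp add: justified_def)
next
  case (ev_succ xs)
  then have "e mod 7 = 1" unfolding decode_unfold[of e] Let_def by (simp split: if_splits)
  moreover have "nthd 0 xs 0 = arg0 xs"
    by (simp add: nthd_def arg0_def nth_Cons' split: list.split)
  ultimately show ?case by (intro justified_eventually[where ws = "[]"]) (simp add: justified_def)
next
  case (ev_proj i xs)
  then have "e mod 7 = 2" "e div 7 = i"
    unfolding decode_unfold[of e] Let_def by (simp_all split: if_splits)
  then show ?case
    by (intro justified_eventually[where ws = "[]"]) (simp add: justified_def nthd_def)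
next
  case (ev_oracle xs)
  then have "e mod 7 = 3" unfolding decode_unfold[of e] Let_def by (simp split: if_splits)
  moreover have arg: "nthd 0 xs 0 = arg0 xs"
    by (simp add: nthd_def arg0_def nth_Cons' split: list.split)
  ultimately show ?case
    by (intro justified_eventually[where ws = "[]"] eventually_mono[OF eventually_gt_at_top[of "arg0 xs"]])
      (simp add: justified_def nthd_def[of False] segment_def)
next
  case (ev_comp xs gs ys f y)
  then obtain m where e: "e mod 7 = 4" "e div 7 = m" "decode (fst (prod_decode m)) = f"
    "gs = map decode (list_decode (snd (prod_decode m)))"
    unfolding decode_unfold[of e] Let_def by (simp split: if_splits)
  let ?gs = "list_decode (snd (prod_decode m))"
  have len: "length ys = length ?gs" using list_all2_lengthD[OF ev_comp.IH(1)] e(4) by simp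
  have "\<forall>\<^sub>F n in sequentially. \<forall>i\<in>{..<length ys}. (?gs ! i, xs, ys ! i) \<in> set (facts (segment A n) n)"
    using ev_comp.IH(1) e(4) len by (intro eventually_ball_finite) (auto simp: list_all2_conv_all_nth)
  moreover have "\<forall>\<^sub>F n in sequentially. (fst (prod_decode m), ys, y) \<in> set (facts (segment A n) n)"
    using ev_comp.IH(2) e(3) by blast
  ultimately show ?case
    by (intro justified_eventually[where ws = ys], eventually_elim)
      (simp add: justified_def Let_def e len nthd_def)
next
  case (ev_prim0 f xs y g)
  then have e: "e mod 7 = 5" "decode (fst (prod_decode (e div 7))) = f"
    unfolding decode_unfold[of e] Let_def by (simp_all split: if_splits)
  have "\<forall>\<^sub>F n in sequentially. (fst (prod_decode (e div 7)), xs, y) \<in> set (facts (segment A n) n)"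
    using ev_prim0.IH e(2) by blast
  then show ?case
    by (intro justified_eventually[where ws = "[]"], eventually_elim)
      (simp add: justified_def Let_def e)
next
  case (ev_primS f g k xs r y)
  then have e: "e mod 7 = 5" "decode (snd (prod_decode (e div 7))) = g"
    unfolding decode_unfold[of e] Let_def by (simp_all split: if_splits)
  have "\<forall>\<^sub>F n in sequentially. (snd (prod_decode (e div 7)), r # k # xs, y) \<in> set (facts (segment A n) n)"
    "\<forall>\<^sub>F n in sequentially. (e, k # xs, r) \<in> set (facts (segment A n) n)"
    using ev_primS.IH ev_primS.prems e(2) by blast+
  then show ?case
    by (intro justified_eventually[where ws = "[r]"], eventually_elim)
      (simp add: justified_def Let_def e)
next
  case (ev_mn f y xs)
  then have e: "e mod 7 = 6" "decode (e div 7) = f"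
    unfolding decode_unfold[of e] Let_def by (simp_all split: if_splits)
  have "\<forall>z. \<exists>v. z < y \<longrightarrow> v \<noteq> 0 \<and>
      (\<forall>e. decode e = f \<longrightarrow> (\<forall>\<^sub>F n in sequentially. (e, z # xs, v) \<in> set (facts (segment A n) n)))"
    using ev_mn.IH(2) by blast
  then obtain v where v: "\<forall>z. z < y \<longrightarrow> v z \<noteq> 0 \<and>
      (\<forall>e. decode e = f \<longrightarrow> (\<forall>\<^sub>F n in sequentially. (e, z # xs, v z) \<in> set (facts (segment A n) n)))"
    by (rule choice[THEN exE])
  have "\<forall>\<^sub>F n in sequentially. \<forall>z\<in>{..<y}. (e div 7, z # xs, v z) \<in> set (facts (segment A n) n)"
    using v e(2) by (intro eventually_ball_finite) auto
  moreover have "\<forall>\<^sub>F n in sequentially. (e div 7, y # xs, 0) \<in> set (facts (segment A n) n)"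
    using ev_mn.IH(1) e(2) by blast
  ultimately show ?case
    by (intro justified_eventually[where ws = "map v [0..<y]"], eventually_elim)
      (simp add: justified_def Let_def e nthd_def v)
qed

lemma ev_complete:
  assumes "eval A (decode e) xs y"
  shows "\<forall>\<^sub>F n in sequentially. ev (segment A n) n e xs = Suc y"
  unfolding ev_eq_Suc using facts_complete[OF assms refl] .

lemma computable_justified [comp_intros]:
  assumes "computable A f1" "computable A f2" "computable A f3" "computable A f4"
    "computable A f5" "computable A f6"
  shows "computable A (\<lambda>x. justified (f1 x) (f2 x) (f3 x) (f4 x) (f5 x) (f6 x))"
  unfolding justified_def
  by (intro comp_intros assms assms[THEN computable_comp])

lemma computable_facts [comp_intros]:
  assumes "computable A f" "computable A n"
  shows "computable A (\<lambda>x. facts (f x) (n x))"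
proof -
  have *: "facts \<tau> s = rec_nat [] (\<lambda>k L. case candidate (fst (prod_decode k)) of (e, xs, y, ws) \<Rightarrow>
     if justified \<tau> L e xs y ws then (e, xs, y) # L else L) s" for \<tau> s
    by (induction s) (simp_all only: facts.simps nat.rec)
  show ?thesis
    unfolding * candidate_def
    by (intro comp_intros assms assms[THEN computable_comp])
qed

lemma computable_ev [comp_intros]:
  assumes "computable A f1" "computable A f2" "computable A f3" "computable A f4"
  shows "computable A (\<lambda>x. ev (f1 x) (f2 x) (f3 x) (f4 x))"
  unfolding ev_def by (intro comp_intros assms assms[THEN computable_comp])

section \<open>Counting mind changes\<close>

text \<open>Sending a change to the potential just before it is injective, and that potential is
  below \<open>B\<close> because it is about to rise.\<close>

lemma changes_le_potential:
  fixes \<Phi> :: "nat \<Rightarrow> nat"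
  assumes mono: "\<And>s. \<Phi> s \<le> \<Phi> (Suc s)" and strict: "\<And>s. g s \<noteq> g (Suc s) \<Longrightarrow> \<Phi> s < \<Phi> (Suc s)"
    and bound: "\<And>s. \<Phi> s \<le> B"
  shows "finite {s. g s \<noteq> g (Suc s)}" "card {s. g s \<noteq> g (Suc s)} \<le> B"
proof -
  let ?S = "{s. g s \<noteq> g (Suc s)}"
  have less: "\<Phi> s < \<Phi> t" if "s \<in> ?S" "s < t" for s t
    using strict[of s] that lift_Suc_mono_le[of \<Phi>, OF mono, of "Suc s" t] by simp
  have inj: "inj_on \<Phi> ?S"
    by (rule inj_onI) (metis less less_irrefl linorder_neqE_nat)
  have sub: "\<Phi> ` ?S \<subseteq> {..<B}"
    using strict bound by (auto intro: less_le_trans)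
  show "finite ?S" using inj sub by (meson finite_imageD finite_lessThan finite_subset)
  show "card ?S \<le> B" using card_inj_on_le[OF inj sub] by simp
qed

lemma finite_changes_eventually_const:
  fixes g :: "nat \<Rightarrow> 'a"
  assumes "finite {s. g s \<noteq> g (Suc s)}"
  shows "\<exists>s0. \<forall>s\<ge>s0. g s = g s0"
proof -
  obtain s0 where s0: "\<And>s. g s \<noteq> g (Suc s) \<Longrightarrow> s < s0"
    using assms finite_nat_set_iff_bounded by auto
  have "g s = g s0" if "s \<ge> s0" for s
    using that
  proof (induction rule: dec_induct)
    case (step n)
    then show ?case using s0[of n] by (metis not_le)
  qed simp
  then show ?thesis by blast
qed

section \<open>The opponents\<close>

text \<open>The string of \<open>s\<close> zeros is the initial segment of length \<open>s\<close>
  of the empty oracle.\<close>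

definition ev0 :: "nat \<Rightarrow> nat \<Rightarrow> nat list \<Rightarrow> nat" where
  "ev0 s e xs = ev (replicate s False) s e xs"

lemma ev0_mono: "ev0 s e xs \<noteq> 0 \<Longrightarrow> s \<le> s' \<Longrightarrow> ev0 s' e xs = ev0 s e xs"
  unfolding ev0_def using ev_mono[of _ s e xs s' "replicate (s' - s) False"]
  by (metis le_add_diff_inverse replicate_add)

lemma ev0_sound: "ev0 s e xs = Suc y \<Longrightarrow> eval {} (decode e) xs y"
  unfolding ev0_def by (rule ev_sound) (auto simp: agrees_def)

lemma ev0_complete:
  assumes "eval {} (decode e) xs y"
  shows "\<forall>\<^sub>F s in sequentially. ev0 s e xs = Suc y"
proof -
  have "segment {} n = replicate n False" for n by (simp add: segment_def map_replicate_const)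
  then show ?thesis using ev_complete[OF assms] by (simp add: ev0_def)
qed

text \<open>
  Program \<open>q\<close>, run on \<open>[q, t]\<close>, is meant to return a bound for the number of changes paired with
  the \<open>t\<close>-th approximation to the index of the \<open>q\<close>-th component of a trace. Level
  \<open>prod_encode (q, v)\<close> of the construction defeats this opponent if the component has at most
  \<open>v\<close> elements.
\<close>

definition tlen :: "nat \<Rightarrow> nat \<Rightarrow> nat" where
  "tlen s q = (LEAST t. t = s \<or> ev0 s q [q, t] = 0)"

text \<open>A genuine opponent repeats the same bound for every \<open>t\<close>. Reading it at 0
  alone fixes it, for every program, as soon as \<open>tlen\<close> is positive. The subtraction
  undoes the successor by which \<open>ev\<close> marks convergence.\<close>

definition bnd :: "nat \<Rightarrow> nat \<Rightarrow> nat" where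
  "bnd s q = fst (prod_decode (ev0 s q [q, 0] - 1))"

definition idx :: "nat \<Rightarrow> nat \<Rightarrow> nat \<Rightarrow> nat" where
  "idx s q t = snd (prod_decode (ev0 s q [q, t] - 1))"

definition cur :: "nat \<Rightarrow> nat \<Rightarrow> nat" where
  "cur s q = idx s q (tlen s q - 1)"

definition chg :: "nat \<Rightarrow> nat \<Rightarrow> nat" where
  "chg s q = length (filter (\<lambda>t. idx s q t \<noteq> idx s q (Suc t)) [0..<tlen s q - 1])"

lemma tlen_le: "tlen s q \<le> s"
  unfolding tlen_def by (rule Least_le) simp

lemma ev0_below_tlen: "t < tlen s q \<Longrightarrow> ev0 s q [q, t] \<noteq> 0"
  unfolding tlen_def by (drule not_less_Least) simp

lemma ev0_tlen_stable: "t < tlen s q \<Longrightarrow> s \<le> s' \<Longrightarrow> ev0 s' q [q, t] = ev0 s q [q, t]"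
  using ev0_below_tlen ev0_mono by blast

lemma le_tlenI:
  assumes "n \<le> s" "\<And>t. t < n \<Longrightarrow> ev0 s q [q, t] \<noteq> 0"
  shows "n \<le> tlen s q"
  unfolding tlen_def
proof (rule LeastI2[of _ s])
  show "n \<le> t" if "t = s \<or> ev0 s q [q, t] = 0" for t
    using assms that by (meson not_le)
qed simp

lemma tlen_mono:
  assumes "s \<le> s'"
  shows "tlen s q \<le> tlen s' q"
proof (rule le_tlenI)
  show "tlen s q \<le> s'" using tlen_le assms by (rule order_trans)
  show "ev0 s' q [q, t] \<noteq> 0" if "t < tlen s q" for t
    using ev0_below_tlen[OF that] ev0_tlen_stable[OF that assms] by simp
qed

lemma idx_stable: "t < tlen s q \<Longrightarrow> s \<le> s' \<Longrightarrow> idx s' q t = idx s q t"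
  unfolding idx_def using ev0_tlen_stable[of t s q s'] by simp

lemma bnd_stable: "0 < tlen s q \<Longrightarrow> s \<le> s' \<Longrightarrow> bnd s' q = bnd s q"
  unfolding bnd_def using ev0_tlen_stable[of 0 s q s'] by simp

lemma chg_eq: "s \<le> s' \<Longrightarrow>
    chg s q = length (filter (\<lambda>t. idx s' q t \<noteq> idx s' q (Suc t)) [0..<tlen s q - 1])"
  unfolding chg_def using idx_stable[of _ s q s']
  by (intro arg_cong[where f = length] filter_cong) auto

lemma chg_split:
  assumes "s \<le> s'"
  shows "chg s' q = chg s q +
    length (filter (\<lambda>t. idx s' q t \<noteq> idx s' q (Suc t)) [tlen s q - 1..<tlen s' q - 1])"
proof -
  have "tlen s q - 1 \<le> tlen s' q - 1" using tlen_mono[OF assms, of q] by simp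
  then have "[0..<tlen s' q - 1] = [0..<tlen s q - 1] @ [tlen s q - 1..<tlen s' q - 1]"
    by (metis le_Suc_ex le0 upt_add_eq_append)
  then show ?thesis by (simp only: chg_eq[OF assms] chg_def[of s'] filter_append length_append)
qed

lemma chg_mono: "s \<le> s' \<Longrightarrow> chg s q \<le> chg s' q"
  by (simp add: chg_split)

text \<open>Two different neighbours among the newly visible approximations would have been counted,
  so the new ones all repeat the last old one.\<close>

lemma cur_stable:
  assumes "s \<le> s'" "0 < tlen s q" "chg s' q = chg s q"
  shows "cur s' q = cur s q"
proof -
  have "\<forall>t\<in>set [tlen s q - 1..<tlen s' q - 1]. idx s' q t = idx s' q (Suc t)"
    using assms(3) chg_split[OF assms(1), of q] by (simp add: filter_empty_conv)
  moreover have "tlen s q - 1 \<le> tlen s' q - 1" using tlen_mono[OF assms(1), of q] by simp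
  moreover have "g n = g m" if "\<forall>t\<in>set [m..<n]. g t = g (Suc t)" "m \<le> n" for m n and g :: "nat \<Rightarrow> nat"
    using that(2,1) by (induction rule: dec_induct) auto
  ultimately have "idx s' q (tlen s' q - 1) = idx s' q (tlen s q - 1)" by blast
  then show ?thesis using idx_stable[of "tlen s q - 1" s q s'] assms(1,2) by (simp add: cur_def)
qed

text \<open>An opponent whose index has changed more often than announced is abandoned for good with
  the witness 0. The cap at \<open>v\<close> makes the search finite and keeps the witness among
  \<open>v + 1\<close> values.\<close>

definition wit :: "nat \<Rightarrow> nat \<Rightarrow> nat" where
  "wit s l = (if tlen s (fst (prod_decode l)) = 0 \<or>
       bnd s (fst (prod_decode l)) < chg s (fst (prod_decode l)) then 0
     else LEAST i. i = snd (prod_decode l) \<or> ev0 s (cur s (fst (prod_decode l))) [i] = 0)"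

text \<open>While its bound \<open>b\<close> is respected, an opponent shows at most
  \<open>b + 1\<close> successive indices, and for each of them the witness climbs through at most
  \<open>v + 1\<close> values. Together with one idle state before convergence and one abandoned
  state at the end, this allows \<open>(v + 1) * (b + 1) + 1\<close> transitions.\<close>

definition marker :: "nat \<Rightarrow> nat \<Rightarrow> nat" where
  "marker s l = (if tlen s (fst (prod_decode l)) = 0 then 0
     else (snd (prod_decode l) + 1) * (bnd s (fst (prod_decode l)) + 1) + 1)"

text \<open>The lexicographic order of index changes and witness, flattened to one number: a witness
  is at most \<open>v\<close>, so with the weight \<open>v + 1\<close> a change of the index
  outweighs any fall of the witness.\<close>

definition wit_pot :: "nat \<Rightarrow> nat \<Rightarrow> nat" where
  "wit_pot s l = (if tlen s (fst (prod_decode l)) = 0 then 0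
     else if bnd s (fst (prod_decode l)) < chg s (fst (prod_decode l)) then marker s l
     else (snd (prod_decode l) + 1) * chg s (fst (prod_decode l)) + wit s l + 1)"

lemma wit_le_snd: "wit s l \<le> snd (prod_decode l)"
  unfolding wit_def by (auto intro!: Least_le)

lemma wit_le: "wit s l \<le> l"
  using wit_le_snd prod_decode_le(2) by (rule order_trans)

lemma wit_pot_le_marker: "wit_pot s l \<le> marker s l"
proof -
  have "(v + 1) * c + w + 1 \<le> (v + 1) * (b + 1) + 1" if "c \<le> b" "w \<le> v" for v c w b :: nat
    using mult_le_mono2[OF that(1), of "v + 1"] that(2) by (simp add: algebra_simps)
  then show ?thesis using wit_le_snd[of s l] by (simp add: wit_pot_def marker_def)
qed

lemma marker_stable:
  "0 < tlen s (fst (prod_decode l)) \<Longrightarrow> s \<le> s' \<Longrightarrow> marker s' l = marker s l"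
  using tlen_mono[of s s' "fst (prod_decode l)"] bnd_stable[of s "fst (prod_decode l)" s']
  by (simp add: marker_def)

lemma wit_pot_mono:
  assumes "s \<le> s'"
  shows "wit_pot s l \<le> wit_pot s' l" "wit s l \<noteq> wit s' l \<Longrightarrow> wit_pot s l < wit_pot s' l"
proof -
  define q v where qv: "q = fst (prod_decode l)" "v = snd (prod_decode l)"
  have "wit_pot s l < wit_pot s' l \<or> wit_pot s l = wit_pot s' l \<and> wit s l = wit s' l"
  proof (cases "tlen s q = 0")
    case True
    then have 0: "wit_pot s l = 0" "wit s l = 0" by (simp_all add: wit_pot_def wit_def qv)
    show ?thesis
    proof (cases "tlen s' q = 0")
      case True
      then show ?thesis using 0 by (simp add: wit_pot_def wit_def qv)
    next
      case False
      then have "0 < wit_pot s' l" by (simp add: wit_pot_def marker_def qv)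
      then show ?thesis using 0 by simp
    qed
  next
    case False
    then have t: "0 < tlen s q" by simp
    then have t': "0 < tlen s' q" using tlen_mono[OF assms, of q] by linarith
    have b: "bnd s' q = bnd s q" using bnd_stable[OF t assms] .
    have c: "chg s q \<le> chg s' q" using chg_mono[OF assms] .
    have m: "marker s' l = marker s l" using marker_stable[OF t[unfolded qv] assms] .
    show ?thesis
    proof (cases "bnd s q < chg s' q")
      case True
      then have s': "wit_pot s' l = marker s l" "wit s' l = 0"
        using t' b m by (simp_all add: wit_pot_def wit_def qv)
      show ?thesis
      proof (cases "bnd s q < chg s q")
        case True
        then show ?thesis using t s' by (simp add: wit_pot_def wit_def qv)
      next
        case F: False
        then have "(v + 1) * chg s q + wit s l + 1 < (v + 1) * (bnd s q + 1) + 1 \<or>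
            (v + 1) * chg s q + wit s l + 1 = (v + 1) * (bnd s q + 1) + 1"
          using wit_pot_le_marker[of s l] t by (auto simp: wit_pot_def marker_def qv)
        moreover have "(v + 1) * chg s q + wit s l < (v + 1) * (bnd s q + 1)"
          using F wit_le_snd[of s l] mult_le_mono2[of "chg s q" "bnd s q" "v + 1"] qv
          by (simp add: algebra_simps)
        ultimately have "wit_pot s l < marker s l"
          using F t by (simp add: wit_pot_def marker_def qv)
        then show ?thesis using s' by simp
      qed
    next
      case False
      then have F: "\<not> bnd s q < chg s q" using c by simp
      have p: "wit_pot s l = (v + 1) * chg s q + wit s l + 1"
        "wit_pot s' l = (v + 1) * chg s' q + wit s' l + 1"
        using False F t t' b by (simp_all add: wit_pot_def qv)
      show ?thesis
      proof (cases "chg s' q = chg s q")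
        case True
        have cur: "cur s' q = cur s q" using cur_stable[OF assms t True] .
        have w: "wit s l = (LEAST i. i = v \<or> ev0 s (cur s q) [i] = 0)"
          "wit s' l = (LEAST i. i = v \<or> ev0 s' (cur s q) [i] = 0)"
          using False F t t' b cur by (simp_all add: wit_def qv)
        define i where "i = wit s' l"
        have "i = v \<or> ev0 s' (cur s q) [i] = 0"
          unfolding i_def w by (rule LeastI[of _ v]) simp
        \<comment> \<open>Computations found by stage \<open>s\<close> remain found, so a number
          still missing at \<open>s'\<close> was missing at \<open>s\<close>. With the index
          unchanged, the least such number can only grow.\<close>
        then have "i = v \<or> ev0 s (cur s q) [i] = 0"
          using ev0_mono[of s "cur s q" "[i]" s'] assms by auto
        then have "wit s l \<le> wit s' l" unfolding w(1) i_def[symmetric] by (rule Least_le)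
        then show ?thesis using p True by auto
      next
        case False
        then have "(v + 1) * chg s q + (v + 1) \<le> (v + 1) * chg s' q"
          using c mult_le_mono2[of "Suc (chg s q)" "chg s' q" "v + 1"] by simp
        then show ?thesis using p wit_le_snd[of s l] qv by simp
      qed
    qed
  qed
  then show "wit_pot s l \<le> wit_pot s' l" "wit s l \<noteq> wit s' l \<Longrightarrow> wit_pot s l < wit_pot s' l"
    by auto
qed

lemma wit_pot_le:
  assumes "0 < tlen s0 (fst (prod_decode l))"
  shows "wit_pot s l \<le> marker s0 l"
proof -
  have "wit_pot s l \<le> wit_pot (max s s0) l" by (rule wit_pot_mono) simp
  also have "\<dots> \<le> marker (max s s0) l" by (rule wit_pot_le_marker)
  also have "\<dots> = marker s0 l" using assms by (rule marker_stable) simp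
  finally show ?thesis .
qed

lemma wit_changes:
  assumes "0 < tlen s0 (fst (prod_decode l))" "marker s0 l \<le> B"
  shows "finite {s. wit s l \<noteq> wit (Suc s) l}" "card {s. wit s l \<noteq> wit (Suc s) l} \<le> B"
proof -
  have "wit_pot s l \<le> B" for s using wit_pot_le[OF assms(1)] assms(2) by (rule order_trans)
  note * = changes_le_potential[of "\<lambda>s. wit_pot s l" "\<lambda>s. wit s l",
      OF wit_pot_mono(1) wit_pot_mono(2) this]
  show "finite {s. wit s l \<noteq> wit (Suc s) l}" "card {s. wit s l \<noteq> wit (Suc s) l} \<le> B"
    by (rule *; simp)+
qed

lemma finite_wit_changes: "finite {s. wit s l \<noteq> wit (Suc s) l}"
proof (cases "\<exists>s. 0 < tlen s (fst (prod_decode l))")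
  case True
  then show ?thesis using wit_changes(1) by blast
qed (simp add: wit_def)

lemma wit_eventually_const: "\<exists>s0. \<forall>s\<ge>s0. wit s l = wit s0 l"
  using finite_changes_eventually_const[OF finite_wit_changes] .

section \<open>The tree of strings\<close>

text \<open>Taking parities makes every number the code of a string, and every string has a
  code.\<close>

definition str :: "nat \<Rightarrow> bool list" where
  "str k = map odd (list_decode (fst (prod_decode k)))"

definition run :: "nat \<Rightarrow> bool list \<Rightarrow> nat \<Rightarrow> nat" where
  "run n \<tau> k = ev (\<tau> @ str k) (snd (prod_decode k)) n [n]"

text \<open>A number \<open>k\<close> codes a proposed extension together with a step bound. The
  value \<open>s\<close> stands for failure so far, so success is expressed by
  \<open>search s n \<tau> < s\<close>.\<close>

definition search :: "nat \<Rightarrow> nat \<Rightarrow> bool list \<Rightarrow> nat" where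
  "search s n \<tau> = (LEAST k. k = s \<or> run n \<tau> k \<noteq> 0)"

definition ext :: "nat \<Rightarrow> nat \<Rightarrow> bool list \<Rightarrow> bool list" where
  "ext s n \<tau> = (if search s n \<tau> < s then \<tau> @ str (search s n \<tau>) else \<tau>)"

definition base :: "nat \<Rightarrow> nat \<Rightarrow> bool list \<Rightarrow> bool list" where
  "base s n \<tau> = ext s n \<tau> @ replicate (marker s n) False"

text \<open>
  The list \<open>\<sigma>\<close> guesses the witnesses at the levels below its length, the last level first.
\<close>

primrec tree :: "nat \<Rightarrow> nat list \<Rightarrow> bool list" where
  "tree s [] = []"
| "tree s (i # \<sigma>) = base s (length \<sigma>) (tree s \<sigma>) @ replicate i True @ [False]"

text \<open>
  A change of the string for \<open>\<sigma>\<close> may undo the search above it; with the weight three the potential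
  increases nevertheless.
\<close>

primrec pot :: "nat \<Rightarrow> nat list \<Rightarrow> nat" where
  "pot s [] = 0"
| "pot s (i # \<sigma>) = 3 * pot s \<sigma> + of_bool (search s (length \<sigma>) (tree s \<sigma>) < s)
     + of_bool (0 < tlen s (fst (prod_decode (length \<sigma>))))"

text \<open>By \<open>wit_le\<close> the actual witnesses always form a valid guess. Level
  \<open>l\<close> leaves \<open>l + 1\<close> choices, which is where the factorial comes
  from.\<close>

primrec valid :: "nat list \<Rightarrow> bool" where
  "valid [] = True"
| "valid (i # \<sigma>) \<longleftrightarrow> i \<le> length \<sigma> \<and> valid \<sigma>"

definition seqs :: "nat \<Rightarrow> nat list set" where
  "seqs n = {\<sigma>. valid \<sigma> \<and> length \<sigma> = n}"

lemma seqs_Suc: "seqs (Suc n) = (\<lambda>(i, \<sigma>). i # \<sigma>) ` ({..n} \<times> seqs n)"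
  unfolding seqs_def by (auto simp: length_Suc_conv image_iff)

lemma finite_seqs: "finite (seqs n)"
proof (induction n)
  case 0
  have "seqs 0 = {[]}" by (auto simp: seqs_def)
  then show ?case by simp
qed (simp add: seqs_Suc)

lemma card_seqs: "card (seqs n) \<le> fact n"
proof (induction n)
  case 0
  have "seqs 0 = {[]}" by (auto simp: seqs_def)
  then show ?case by simp
next
  case (Suc n)
  have "card (seqs (Suc n)) \<le> card ({..n} \<times> seqs n)"
    unfolding seqs_Suc by (rule card_image_le) (simp add: finite_seqs)
  also have "\<dots> \<le> Suc n * fact n" unfolding card_cartesian_product card_atMost by (rule mult_le_mono2[OF Suc])
  finally show ?case by simp
qed

section \<open>Monotonicity of the potential and the number of strings\<close>

lemma search_stable:
  assumes "search s n \<tau> < s" "s \<le> s'"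
  shows "search s' n \<tau> = search s n \<tau>"
  unfolding search_def[of s']
proof (rule Least_equality)
  have "search s n \<tau> = s \<or> run n \<tau> (search s n \<tau>) \<noteq> 0"
    unfolding search_def by (rule LeastI[of _ s]) simp
  then show "search s n \<tau> = s' \<or> run n \<tau> (search s n \<tau>) \<noteq> 0" using assms(1) by simp
  show "search s n \<tau> \<le> k" if "k = s' \<or> run n \<tau> k \<noteq> 0" for k
    using that
  proof
    assume "run n \<tau> k \<noteq> 0"
    then show ?thesis unfolding search_def by (intro Least_le) simp
  qed (use assms in simp)
qed

lemma ext_stable: "search s n \<tau> < s \<Longrightarrow> s \<le> s' \<Longrightarrow> ext s' n \<tau> = ext s n \<tau>"
  using search_stable[of s n \<tau> s'] by (simp add: ext_def)

lemma pot_mono_tree: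
  assumes "s \<le> s'"
  shows "pot s \<sigma> < pot s' \<sigma> \<or> pot s \<sigma> = pot s' \<sigma> \<and> tree s \<sigma> = tree s' \<sigma>"
proof (induction \<sigma>)
  case (Cons i \<sigma>)
  let ?n = "length \<sigma>" and ?\<tau> = "tree s \<sigma>"
  have t: "tlen s q \<le> tlen s' q" for q using tlen_mono[OF assms] .
  show ?case
    using Cons
  proof
    \<comment> \<open>The rise below is worth at least 3 here. Of the two bits of this level only
      the search bit can be lost, as \<open>tlen\<close> never decreases.\<close>
    assume "pot s \<sigma> < pot s' \<sigma>"
    then show ?thesis using t[of "fst (prod_decode ?n)"] by (auto simp: of_bool_def)
  next
    assume eq: "pot s \<sigma> = pot s' \<sigma> \<and> tree s \<sigma> = tree s' \<sigma>"
    have A: "\<not> search s ?n ?\<tau> < s \<and> search s' ?n ?\<tau> < s' \<or>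
        (search s ?n ?\<tau> < s \<longleftrightarrow> search s' ?n ?\<tau> < s') \<and> ext s ?n ?\<tau> = ext s' ?n ?\<tau>"
      using search_stable[of s ?n ?\<tau> s'] ext_stable[of s ?n ?\<tau> s'] assms
      by (cases "search s ?n ?\<tau> < s") (auto simp: ext_def)
    have B: "\<not> 0 < tlen s (fst (prod_decode ?n)) \<and> 0 < tlen s' (fst (prod_decode ?n)) \<or>
        (0 < tlen s (fst (prod_decode ?n)) \<longleftrightarrow> 0 < tlen s' (fst (prod_decode ?n))) \<and>
        marker s ?n = marker s' ?n"
      using marker_stable[of s ?n s'] t[of "fst (prod_decode ?n)"] assms
      by (cases "0 < tlen s (fst (prod_decode ?n))") (auto simp: marker_def)
    show ?thesis
      using A B eq by (elim disjE) (auto simp: base_def of_bool_def)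
  qed
qed simp

lemma tree_eq_if_pot_eq: "pot s \<sigma> = pot s' \<sigma> \<Longrightarrow> tree s \<sigma> = tree s' \<sigma>"
  using pot_mono_tree[of s s' \<sigma>] pot_mono_tree[of s' s \<sigma>] by (metis less_irrefl nle_le)

text \<open>The two bits of a level sum to at most 2, so the potential is a ternary number with one
  digit per level.\<close>

lemma pot_less: "pot s \<sigma> < 3 ^ length \<sigma>"
proof (induction \<sigma>)
  case (Cons i \<sigma>)
  have "3 * a + of_bool P + of_bool Q < 3 * b" if "a < b" for a b :: nat and P Q
    using that by (simp add: of_bool_def)
  from this[OF Cons] show ?case by simp
qed simp

text \<open>Equal potentials give equal strings even at distant stages, so the string is a function
  of the potential.\<close>

lemma card_range_tree: "finite (range (\<lambda>s. tree s \<sigma>))" "card (range (\<lambda>s. tree s \<sigma>)) \<le> 3 ^ length \<sigma>"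
proof -
  define g where "g p = tree (SOME s. pot s \<sigma> = p) \<sigma>" for p
  have "tree s \<sigma> = g (pot s \<sigma>)" for s
  proof -
    have "pot (SOME t. pot t \<sigma> = pot s \<sigma>) \<sigma> = pot s \<sigma>" by (rule someI[of _ s]) simp
    then show ?thesis unfolding g_def by (intro tree_eq_if_pot_eq) simp
  qed
  then have sub: "range (\<lambda>s. tree s \<sigma>) \<subseteq> g ` {..<3 ^ length \<sigma>}"
    using pot_less[of _ \<sigma>] by auto
  then show "finite (range (\<lambda>s. tree s \<sigma>))" by (rule finite_subset) simp
  have "card (range (\<lambda>s. tree s \<sigma>)) \<le> card (g ` {..<3 ^ length \<sigma>})"
    using sub by (rule card_mono[rotated]) simp
  also have "\<dots> \<le> 3 ^ length \<sigma>" using card_image_le[of "{..<3 ^ length \<sigma>}" g] by simp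
  finally show "card (range (\<lambda>s. tree s \<sigma>)) \<le> 3 ^ length \<sigma>" .
qed

text \<open>Quantifying over all guesses, not only the current one, gives the number of these stages
  a computable bound on which the opponents have no influence.\<close>

definition active :: "nat \<Rightarrow> nat set" where
  "active n = {s. \<exists>\<sigma>\<in>seqs n. pot s \<sigma> \<noteq> pot (Suc s) \<sigma>}"

lemma active_bound: "finite (active n)" "card (active n) \<le> fact n * 3 ^ n"
proof -
  have *: "active n = (\<Union>\<sigma>\<in>seqs n. {s. pot s \<sigma> \<noteq> pot (Suc s) \<sigma>})" by (auto simp: active_def)
  have fc: "finite {s. pot s \<sigma> \<noteq> pot (Suc s) \<sigma>} \<and> card {s. pot s \<sigma> \<noteq> pot (Suc s) \<sigma>} \<le> 3 ^ n"
    if "\<sigma> \<in> seqs n" for \<sigma>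
  proof -
    have le: "pot s \<sigma> \<le> pot (Suc s) \<sigma>" for s using pot_mono_tree[of s "Suc s" \<sigma>] by auto
    have bound: "pot s \<sigma> \<le> 3 ^ n" for s using pot_less[of s \<sigma>] that by (simp add: seqs_def)
    show ?thesis
      using changes_le_potential[of "\<lambda>s. pot s \<sigma>" "\<lambda>s. pot s \<sigma>" "3 ^ n"] le bound
      by (simp add: order_less_le)
  qed
  show "finite (active n)" unfolding * using fc finite_seqs by blast
  have "card (active n) \<le> (\<Sum>\<sigma>\<in>seqs n. card {s. pot s \<sigma> \<noteq> pot (Suc s) \<sigma>})"
    unfolding * by (rule card_UN_le[OF finite_seqs])
  also have "\<dots> \<le> (\<Sum>\<sigma>\<in>seqs n. 3 ^ n)" by (rule sum_mono) (use fc in blast)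
  also have "\<dots> \<le> fact n * 3 ^ n" using card_seqs[of n] by simp
  finally show "card (active n) \<le> fact n * 3 ^ n" .
qed

lemma active_Suc: "active n \<subseteq> active (Suc n)"
proof
  fix s assume "s \<in> active n"
  then obtain \<sigma> where \<sigma>: "\<sigma> \<in> seqs n" "pot s \<sigma> \<noteq> pot (Suc s) \<sigma>" by (auto simp: active_def)
  then have "0 # \<sigma> \<in> seqs (Suc n)" by (simp add: seqs_def)
  moreover have "pot s \<sigma> < pot (Suc s) \<sigma>" using pot_mono_tree[of s "Suc s" \<sigma>] \<sigma>(2) by simp
  then have "pot s (0 # \<sigma>) \<noteq> pot (Suc s) (0 # \<sigma>)" by (simp add: of_bool_def)
  ultimately show "s \<in> active (Suc n)" unfolding active_def by blast
qed

lemma active_mono: "m \<le> n \<Longrightarrow> active m \<subseteq> active n"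
  by (rule lift_Suc_mono_le[of active, OF active_Suc])

lemma tree_quiet:
  assumes "s \<notin> active n" "length \<sigma> \<le> n" "valid \<sigma>"
  shows "tree (Suc s) \<sigma> = tree s \<sigma>"
proof (rule tree_eq_if_pot_eq)
  have "s \<notin> active (length \<sigma>)" using active_mono[OF assms(2)] assms(1) by blast
  then show "pot (Suc s) \<sigma> = pot s \<sigma>" using assms(3) by (auto simp: active_def seqs_def)
qed

text \<open>Guessing the witness 0 next turns the base into a string of the tree, up to the closing
  zero.\<close>

lemma base_quiet:
  assumes "s \<notin> active n" "length \<sigma> < n" "valid \<sigma>"
  shows "base (Suc s) (length \<sigma>) (tree s \<sigma>) = base s (length \<sigma>) (tree s \<sigma>)"
  using tree_quiet[OF assms(1), of "0 # \<sigma>"] tree_quiet[OF assms(1), of \<sigma>] assms(2,3) by simp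

section \<open>The set\<close>

primrec wits :: "nat \<Rightarrow> nat \<Rightarrow> nat list" where
  "wits s 0 = []"
| "wits s (Suc n) = wit s n # wits s n"

lemma length_wits [simp]: "length (wits s n) = n"
  by (induction n) auto

lemma valid_wits [simp]: "valid (wits s n)"
  by (induction n) (auto simp: wit_le)

lemma wits_in_seqs: "wits s n \<in> seqs n"
  by (simp add: seqs_def)

lemma length_tree: "length \<sigma> \<le> length (tree s \<sigma>)"
proof (induction \<sigma>)
  case (Cons i \<sigma>)
  then show ?case by (auto simp: base_def ext_def)
qed simp

lemma base_append: "\<exists>u. base s n \<tau> = \<tau> @ u"
  by (simp add: base_def ext_def)

lemma tree_wits_append: "m \<le> n \<Longrightarrow> \<exists>u. tree s (wits s n) = tree s (wits s m) @ u"
proof (induction rule: dec_induct)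
  case (step n)
  then show ?case using base_append[of s n "tree s (wits s n)"] by auto
qed simp

text \<open>Each level contributes at least its closing \<open>False\<close>, so
  \<open>Suc x\<close> levels already reach position \<open>x\<close>.\<close>

definition approx :: "nat \<Rightarrow> nat \<Rightarrow> bool" where
  "approx s x = tree s (wits s (Suc x)) ! x"

lemma less_length_tree_wits: "x < length (tree s (wits s (Suc x)))"
  using length_tree[of "wits s (Suc x)" s] by simp

lemma approx_eq:
  assumes "x < length (tree s (wits s n))"
  shows "approx s x = tree s (wits s n) ! x"
proof (cases "n \<le> Suc x")
  case True
  then obtain u where u: "tree s (wits s (Suc x)) = tree s (wits s n) @ u"
    using tree_wits_append by blast
  show ?thesis by (simp only: approx_def u nth_append assms if_True)
next
  case False
  then obtain u where u: "tree s (wits s n) = tree s (wits s (Suc x)) @ u"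
    using tree_wits_append[of "Suc x" n s] by auto
  show ?thesis by (simp only: approx_def u nth_append less_length_tree_wits if_True)
qed

text \<open>At a stage where no string at a fixed guess changes, consider the lowest level whose
  witness does. The base of that level is the same before and after, so a changed bit
  \<open>x\<close> must lie beyond it. The zeros in the base then number at most \<open>x\<close>,
  and so do all changes of this witness.\<close>

lemma approx_changes:
  "finite {s. approx s x \<noteq> approx (Suc s) x}"
  "card {s. approx s x \<noteq> approx (Suc s) x} \<le> fact (Suc x) * 3 ^ Suc x + Suc x * x"
proof -
  \<comment> \<open>While the opponent is silent its marker is 0 and bounds nothing; a small marker
    counts only at a stage where \<open>tlen\<close> is positive.\<close>
  define C where "C l = (if \<exists>s. 0 < tlen s (fst (prod_decode l)) \<and> marker s l \<le> x
    then {s. wit s l \<noteq> wit (Suc s) l} else {})" for l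
  have C: "finite (C l)" "card (C l) \<le> x" for l
    using wit_changes[of _ l x] by (auto simp: C_def)
  have sub: "{s. approx s x \<noteq> approx (Suc s) x} \<subseteq> active (Suc x) \<union> (\<Union>l<Suc x. C l)"
  proof
    fix s assume "s \<in> {s. approx s x \<noteq> approx (Suc s) x}"
    then have ch: "approx s x \<noteq> approx (Suc s) x" by simp
    show "s \<in> active (Suc x) \<union> (\<Union>l<Suc x. C l)"
    proof (rule ccontr)
      assume "s \<notin> active (Suc x) \<union> (\<Union>l<Suc x. C l)"
      then have quiet: "s \<notin> active (Suc x)" and nC: "s \<notin> (\<Union>l<Suc x. C l)" by auto
      have "wits s n = wits (Suc s) n \<and> n \<le> Suc x" if "n \<le> Suc x" for n
        using that
      proof (induction n)
        case (Suc l)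
        then have eq: "wits (Suc s) l = wits s l" and l: "l < Suc x" by auto
        have "wit s l = wit (Suc s) l"
        proof (rule ccontr)
          assume ne: "wit s l \<noteq> wit (Suc s) l"
          define \<beta> where "\<beta> = base s l (tree s (wits s l))"
          have \<beta>: "base (Suc s) l (tree (Suc s) (wits (Suc s) l)) = \<beta>"
            unfolding \<beta>_def eq using base_quiet[OF quiet, of "wits s l"] tree_quiet[OF quiet, of "wits s l"] l
            by simp
          have "\<exists>u. tree s (wits s (Suc l)) = \<beta> @ u" "\<exists>u. tree (Suc s) (wits (Suc s) (Suc l)) = \<beta> @ u"
            using \<beta> by (simp_all add: \<beta>_def)
          then have "length \<beta> \<le> x"
            using ch approx_eq[of x s "Suc l"] approx_eq[of x "Suc s" "Suc l"]
            by (cases "x < length \<beta>") (auto simp del: tree.simps wits.simps simp: nth_append)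
          moreover have "marker (Suc s) l \<le> length \<beta>" unfolding \<beta>[symmetric] by (simp add: base_def)
          \<comment> \<open>If the opponent were still silent at \<open>Suc s\<close>, it was silent
            at \<open>s\<close> too, and both witnesses would be 0.\<close>
          moreover have "0 < tlen (Suc s) (fst (prod_decode l))"
          proof (rule ccontr)
            assume "\<not> 0 < tlen (Suc s) (fst (prod_decode l))"
            then show False
              using ne tlen_mono[of s "Suc s" "fst (prod_decode l)"] by (simp add: wit_def)
          qed
          ultimately have "s \<in> C l" using ne by (auto simp: C_def)
          then show False using nC l by blast
        qed
        then show ?case using Suc eq by simp
      qed simp
      then have "wits (Suc s) (Suc x) = wits s (Suc x)" by fastforce
      then have "approx (Suc s) x = approx s x"
        unfolding approx_def using tree_quiet[OF quiet, of "wits s (Suc x)"]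
        by (simp only: length_wits valid_wits order_refl)
      then show False using ch by simp
    qed
  qed
  have fin: "finite (active (Suc x) \<union> (\<Union>l<Suc x. C l))" using active_bound(1) C(1) by blast
  show "finite {s. approx s x \<noteq> approx (Suc s) x}" using finite_subset[OF sub fin] .
  have "card (\<Union>l<Suc x. C l) \<le> (\<Sum>l<Suc x. card (C l))" by (rule card_UN_le) simp
  also have "\<dots> \<le> (\<Sum>l<Suc x. x)" by (rule sum_mono) (rule C(2))
  finally have "card (\<Union>l<Suc x. C l) \<le> Suc x * x" by simp
  then have "card (active (Suc x) \<union> (\<Union>l<Suc x. C l)) \<le> fact (Suc x) * 3 ^ Suc x + Suc x * x"
    using card_Un_le[of "active (Suc x)" "\<Union>l<Suc x. C l"] active_bound(2)[of "Suc x"] by linarith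
  then show "card {s. approx s x \<noteq> approx (Suc s) x} \<le> fact (Suc x) * 3 ^ Suc x + Suc x * x"
    using card_mono[OF fin sub] by linarith
qed

section \<open>The limit and the stages at which it has been reached\<close>

definition limset :: "nat set" where
  "limset = {x. \<exists>s0. \<forall>s\<ge>s0. approx s x}"

definition settled :: "nat \<Rightarrow> nat \<Rightarrow> bool" where
  "settled n s0 \<longleftrightarrow> (\<forall>s\<ge>s0. s \<notin> active n \<and> wits s n = wits s0 n)"

lemma wits_eventually_const: "\<exists>s0. \<forall>s\<ge>s0. wits s n = wits s0 n"
proof (induction n)
  case (Suc n)
  then obtain s1 where s1: "\<And>s. s \<ge> s1 \<Longrightarrow> wits s n = wits s1 n" by blast
  obtain s2 where s2: "\<And>s. s \<ge> s2 \<Longrightarrow> wit s n = wit s2 n" using wit_eventually_const[of n] by blast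
  have "wits s (Suc n) = wits (max s1 s2) (Suc n)" if "s \<ge> max s1 s2" for s
    using s1[of s] s1[of "max s1 s2"] s2[of s] s2[of "max s1 s2"] that by simp
  then show ?case by blast
qed simp

lemma ex_settled: "\<exists>s0. settled n s0"
proof -
  obtain s1 where s1: "\<And>s. s \<ge> s1 \<Longrightarrow> wits s n = wits s1 n" using wits_eventually_const[of n] by blast
  obtain s2 where s2: "\<And>s. s \<in> active n \<Longrightarrow> s < s2"
    using active_bound(1)[of n, unfolded finite_nat_set_iff_bounded] by blast
  have "settled n (max s1 s2)"
    unfolding settled_def
  proof (intro allI impI conjI)
    fix s assume s: "max s1 s2 \<le> s"
    show "s \<notin> active n" using s2[of s] s by auto
    show "wits s n = wits (max s1 s2) n" using s1[of s] s1[of "max s1 s2"] s by simp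
  qed
  then show ?thesis ..
qed

lemma settledD:
  assumes "settled n s0" "s0 \<le> s"
  shows "s \<notin> active n" "wits s n = wits s0 n"
  using assms unfolding settled_def by blast+

lemma settled_tree:
  assumes "settled n s0" "s0 \<le> s"
  shows "tree s (wits s n) = tree s0 (wits s0 n)"
proof -
  have w: "wits s n = wits s0 n" using settledD(2)[OF assms] .
  have "tree s (wits s0 n) = tree s0 (wits s0 n)"
    using assms(2)
  proof (induction rule: dec_induct)
    case (step t)
    have "t \<notin> active n" using settledD(1)[OF assms(1) step(1)] .
    then show ?case using tree_quiet[of t n "wits s0 n"] step by simp
  qed simp
  then show ?thesis by (simp add: w)
qed

lemma settled_agrees:
  assumes "settled n s0" "s0 \<le> s"
  shows "agrees (tree s (wits s n)) limset"
  unfolding agrees_def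
proof (intro allI impI)
  fix i assume i: "i < length (tree s (wits s n))"
  have *: "approx t i = tree s (wits s n) ! i" if "s0 \<le> t" for t
    using approx_eq[of i t n] i settled_tree[OF assms(1)] that assms(2) by metis
  show "tree s (wits s n) ! i \<longleftrightarrow> i \<in> limset"
  proof
    assume "tree s (wits s n) ! i"
    then show "i \<in> limset" using * by (auto simp: limset_def)
  next
    assume "i \<in> limset"
    then obtain s1 where "\<forall>t\<ge>s1. approx t i" by (auto simp: limset_def)
    then have "approx (max s0 s1) i" by simp
    then show "tree s (wits s n) ! i" using *[of "max s0 s1"] by simp
  qed
qed

lemma agrees_append: "agrees (\<tau> @ u) A \<Longrightarrow> agrees \<tau> A"
  by (auto simp: agrees_def nth_append split: if_splits)

lemma agrees_segment: "agrees \<tau> A \<Longrightarrow> \<tau> = segment A (length \<tau>)"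
  by (rule nth_equalityI) (auto simp: segment_def agrees_def)

lemma approx_eventually: "\<exists>s0. \<forall>s\<ge>s0. approx s x \<longleftrightarrow> x \<in> limset"
proof -
  obtain s0 where s0: "settled (Suc x) s0" using ex_settled by (rule exE)
  have "approx s x \<longleftrightarrow> x \<in> limset" if "s \<ge> s0" for s
    using settled_agrees[OF s0 that] less_length_tree_wits[of x s] unfolding agrees_def approx_def by blast
  then show ?thesis by blast
qed

section \<open>Tracing the jump\<close>

definition jval :: "nat \<Rightarrow> nat \<Rightarrow> bool list \<Rightarrow> nat" where
  "jval s n \<tau> = (if search s n \<tau> < s then run n \<tau> (search s n \<tau>) else 0)"

text \<open>The final guess is known only in the limit, so a c.e. trace has to collect the values
  for all guesses and all stages.\<close>

definition trace :: "nat \<Rightarrow> nat set" where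
  "trace n = {y. \<exists>s. \<exists>\<sigma>\<in>seqs n. jval s n (tree s \<sigma>) = Suc y}"

lemma jval_fun:
  assumes "jval s n \<tau> \<noteq> 0" "jval s' n \<tau> \<noteq> 0"
  shows "jval s n \<tau> = jval s' n \<tau>"
proof -
  have "jval t n \<tau> = jval t' n \<tau>" if "jval t n \<tau> \<noteq> 0" "t \<le> t'" for t t'
    using that search_stable[of t n \<tau> t'] by (auto simp: jval_def split: if_splits)
  then show ?thesis using assms by (metis nle_le)
qed

text \<open>A successful search from a fixed string is never revised, so each string contributes at
  most one value; it remains to count the strings that guesses ever receive.\<close>

lemma trace_bound: "finite (trace n)" "card (trace n) \<le> fact n * 3 ^ n"
proof -
  define R where "R = (\<Union>\<sigma>\<in>seqs n. range (\<lambda>s. tree s \<sigma>))"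
  define g where "g \<tau> = (THE y. \<exists>s. jval s n \<tau> = Suc y)" for \<tau>
  have fin: "finite R" unfolding R_def using finite_seqs card_range_tree(1) by blast
  have "card R \<le> (\<Sum>\<sigma>\<in>seqs n. card (range (\<lambda>s. tree s \<sigma>)))"
    unfolding R_def by (rule card_UN_le[OF finite_seqs])
  also have "\<dots> \<le> (\<Sum>\<sigma>\<in>seqs n. 3 ^ n)"
    using card_range_tree(2) by (intro sum_mono) (auto simp: seqs_def)
  also have "\<dots> \<le> fact n * 3 ^ n" using card_seqs[of n] by simp
  finally have card: "card R \<le> fact n * 3 ^ n" .
  have sub: "trace n \<subseteq> g ` R"
  proof
    fix y assume "y \<in> trace n"
    then obtain s \<sigma> where s: "\<sigma> \<in> seqs n" "jval s n (tree s \<sigma>) = Suc y" by (auto simp: trace_def)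
    have "g (tree s \<sigma>) = y"
      unfolding g_def
    proof (rule the_equality)
      show "\<exists>s'. jval s' n (tree s \<sigma>) = Suc y" using s(2) by blast
      show "z = y" if "\<exists>s'. jval s' n (tree s \<sigma>) = Suc z" for z
        using that s(2) jval_fun by (metis nat.distinct(1) nat.inject)
    qed
    moreover have "tree s \<sigma> \<in> R" using s(1) by (auto simp: R_def)
    ultimately show "y \<in> g ` R" by blast
  qed
  show "finite (trace n)" using finite_subset[OF sub] fin by simp
  show "card (trace n) \<le> fact n * 3 ^ n"
    using card_mono[OF _ sub] card_image_le[OF fin, of g] card fin by simp
qed

text \<open>The convergent computation has finite use, which makes the search from the final string
  succeed. It may find a different extension than the one seen in the set at first, but what it
  finds is then built into the set, so by determinacy its value is the value of the jump.\<close>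

lemma jump_in_trace:
  assumes "eval limset (decode n) [n] y"
  shows "y \<in> trace n"
proof -
  \<comment> \<open>The extension chosen at level \<open>n\<close> is part of the string for a guess
    of length \<open>Suc n\<close>, so that one has to be settled.\<close>
  obtain s0 where s0: "settled (Suc n) s0" using ex_settled by (rule exE)
  define \<tau> where "\<tau> = tree s0 (wits s0 n)"
  have \<tau>: "tree s (wits s n) = \<tau>" if "s \<ge> s0" for s
  proof -
    have "settled n s0"
      unfolding settled_def
    proof (intro allI impI conjI)
      fix t assume t: "s0 \<le> t"
      show "t \<notin> active n" using settledD(1)[OF s0 t] active_Suc[of n] by blast
      show "wits t n = wits s0 n" using settledD(2)[OF s0 t] by simp
    qed
    from settled_tree[OF this that] show ?thesis by (simp only: \<tau>_def)
  qed
  have \<tau>_agrees: "agrees (ext s n \<tau>) limset" if "s \<ge> s0" for s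
  proof -
    have "tree s (wits s (Suc n)) =
        ext s n \<tau> @ replicate (marker s n) False @ replicate (wit s n) True @ [False]"
      using \<tau>[OF that] by (simp add: base_def)
    then show ?thesis using settled_agrees[OF s0 that] agrees_append by metis
  qed
  obtain N where N: "\<forall>k\<ge>N. ev (segment limset k) k n [n] = Suc y"
    using ev_complete[OF assms] unfolding eventually_sequentially by blast
  define k where "k = max N (length \<tau>)"
  have k: "k \<ge> length \<tau>" "ev (segment limset k) k n [n] = Suc y"
    using N by (simp_all add: k_def)
  have "\<exists>u. ext s0 n \<tau> = \<tau> @ u" by (simp add: ext_def)
  then obtain u0 where "ext s0 n \<tau> = \<tau> @ u0" ..
  then have "agrees \<tau> limset" using \<tau>_agrees[of s0] agrees_append by simp
  then have "\<tau> = segment limset (length \<tau>)" by (rule agrees_segment)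
  then obtain u where u: "segment limset k = \<tau> @ u" using segment_append[OF k(1)] by metis
  have "map odd (map of_bool u :: nat list) = u" by (simp add: comp_def)
  then have str: "str (prod_encode (list_encode (map of_bool u), k)) = u" by (simp add: str_def)
  define K where "K = prod_encode (list_encode (map of_bool u), k)"
  have run: "run n \<tau> K \<noteq> 0" using k(2) str u by (simp add: run_def K_def)
  define s where "s = max s0 (Suc K)"
  have "search s n \<tau> \<le> K" unfolding search_def by (rule Least_le) (simp add: run)
  then have less: "search s n \<tau> < s" by (simp add: s_def)
  have "search s n \<tau> = s \<or> run n \<tau> (search s n \<tau>) \<noteq> 0"
    unfolding search_def by (rule LeastI[of _ s]) simp
  then obtain z where z: "run n \<tau> (search s n \<tau>) = Suc z"
    using less by (metis less_irrefl not0_implies_Suc)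
  have "agrees (\<tau> @ str (search s n \<tau>)) limset"
    using \<tau>_agrees[of s] less by (simp add: ext_def s_def)
  then have "eval limset (decode n) [n] z" using z unfolding run_def by (rule ev_sound)
  then have "z = y" using eval_det assms by blast
  moreover have "jval s n (tree s (wits s n)) = Suc z"
    using less z \<tau>[of s] by (simp add: jval_def s_def)
  ultimately show ?thesis unfolding trace_def using wits_in_seqs by blast
qed

section \<open>Reading off the witnesses\<close>

text \<open>The block of ones after the base is read from the oracle. The cap \<open>n\<close> ends
  the search and keeps the guess valid even at stages where the base is wrong and no zero need
  follow.\<close>

primrec guess :: "nat set \<Rightarrow> nat \<Rightarrow> nat \<Rightarrow> nat list" where
  "guess A s 0 = []"
| "guess A s (Suc n) =
    (LEAST i. i = n \<or> length (base s n (tree s (guess A s n))) + i \<notin> A) # guess A s n"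

lemma length_guess [simp]: "length (guess A s n) = n"
  by (induction n) auto

lemma valid_guess [simp]: "valid (guess A s n)"
  by (induction n) (auto intro!: Least_le)

text \<open>The oracle does not move with \<open>s\<close>, so a reading can change only when the
  string at some valid guess changes.\<close>

lemma guess_quiet: "s \<notin> active n \<Longrightarrow> m \<le> n \<Longrightarrow> guess A (Suc s) m = guess A s m"
proof (induction m)
  case (Suc m)
  then have "guess A (Suc s) m = guess A s m" by simp
  moreover have "base (Suc s) m (tree (Suc s) (guess A s m)) = base s m (tree s (guess A s m))"
    using base_quiet[of s n "guess A s m"] tree_quiet[of s n "guess A s m"] Suc.prems by simp
  ultimately show ?case by simp
qed simp

lemma guess_eq_wits:
  assumes "settled n s0" "s0 \<le> s" "m \<le> n"
  shows "guess limset s m = wits s m"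
  using assms(3)
proof (induction m)
  case (Suc m)
  define \<beta> where "\<beta> = base s m (tree s (wits s m))"
  obtain u where "tree s (wits s n) = tree s (wits s (Suc m)) @ u"
    using tree_wits_append[OF Suc.prems] by blast
  then have "agrees (\<beta> @ replicate (wit s m) True @ [False]) limset"
    using settled_agrees[OF assms(1,2)] agrees_append by (simp add: \<beta>_def)
  then have agr: "(\<beta> @ replicate (wit s m) True @ [False]) ! i \<longleftrightarrow> i \<in> limset"
    if "i < length \<beta> + wit s m + 1" for i
    using that by (simp add: agrees_def)
  have "(LEAST i. i = m \<or> length \<beta> + i \<notin> limset) = wit s m"
  proof (rule Least_equality)
    show "wit s m = m \<or> length \<beta> + wit s m \<notin> limset"
      using agr[of "length \<beta> + wit s m"] by (simp add: nth_append)
    show "wit s m \<le> i" if "i = m \<or> length \<beta> + i \<notin> limset" for i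
    proof (rule ccontr)
      assume "\<not> wit s m \<le> i"
      then show False using that agr[of "length \<beta> + i"] wit_le[of s m] by (auto simp: nth_append)
    qed
  qed
  then show ?case using Suc by (simp add: \<beta>_def)
qed simp

section \<open>Computability of the construction\<close>

lemma computable_ev0 [comp_intros]:
  assumes "computable A f1" "computable A f2" "computable A f3"
  shows "computable A (\<lambda>x. ev0 (f1 x) (f2 x) (f3 x))"
  unfolding ev0_def by (intro comp_intros assms)

lemma computable_tlen [comp_intros]:
  assumes "computable A f1" "computable A f2"
  shows "computable A (\<lambda>x. tlen (f1 x) (f2 x))"
  unfolding tlen_def by (intro comp_intros assms assms[THEN computable_comp]) auto

lemma computable_bnd [comp_intros]:
  assumes "computable A f1" "computable A f2"
  shows "computable A (\<lambda>x. bnd (f1 x) (f2 x))"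
  unfolding bnd_def by (intro comp_intros assms)

lemma computable_idx [comp_intros]:
  assumes "computable A f1" "computable A f2" "computable A f3"
  shows "computable A (\<lambda>x. idx (f1 x) (f2 x) (f3 x))"
  unfolding idx_def by (intro comp_intros assms)

lemma computable_cur [comp_intros]:
  assumes "computable A f1" "computable A f2"
  shows "computable A (\<lambda>x. cur (f1 x) (f2 x))"
  unfolding cur_def by (intro comp_intros assms)

lemma computable_chg [comp_intros]:
  assumes "computable A f1" "computable A f2"
  shows "computable A (\<lambda>x. chg (f1 x) (f2 x))"
  unfolding chg_def by (intro comp_intros assms assms[THEN computable_comp])

lemma computable_wit [comp_intros]:
  assumes "computable A f1" "computable A f2"
  shows "computable A (\<lambda>x. wit (f1 x) (f2 x))"
  unfolding wit_def by (intro comp_intros assms assms[THEN computable_comp]) auto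

lemma computable_marker [comp_intros]:
  assumes "computable A f1" "computable A f2"
  shows "computable A (\<lambda>x. marker (f1 x) (f2 x))"
  unfolding marker_def by (intro comp_intros assms)

lemma computable_run [comp_intros]:
  assumes "computable A f1" "computable A f2" "computable A f3"
  shows "computable A (\<lambda>x. run (f1 x) (f2 x) (f3 x))"
  unfolding run_def str_def odd_iff_mod_2_eq_one by (intro comp_intros assms)

lemma computable_search [comp_intros]:
  assumes "computable A f1" "computable A f2" "computable A f3"
  shows "computable A (\<lambda>x. search (f1 x) (f2 x) (f3 x))"
  unfolding search_def by (intro comp_intros assms assms[THEN computable_comp]) auto

lemma computable_base [comp_intros]:
  assumes "computable A f1" "computable A f2" "computable A f3"
  shows "computable A (\<lambda>x. base (f1 x) (f2 x) (f3 x))"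
  unfolding base_def ext_def str_def odd_iff_mod_2_eq_one by (intro comp_intros assms)

lemma computable_tree [comp_intros]:
  assumes "computable A f1" "computable A f2"
  shows "computable A (\<lambda>x. tree (f1 x) (f2 x))"
proof -
  have *: "tree s \<sigma> = rec_list [] (\<lambda>i \<sigma> r. base s (length \<sigma>) r @ replicate i True @ [False]) \<sigma>"
    for s \<sigma> by (induction \<sigma>) simp_all
  show ?thesis unfolding * by (intro comp_intros assms assms[THEN computable_comp])
qed

lemma computable_wits [comp_intros]:
  assumes "computable A f1" "computable A f2"
  shows "computable A (\<lambda>x. wits (f1 x) (f2 x))"
proof -
  have *: "wits s n = rec_nat [] (\<lambda>n r. wit s n # r) n" for s n by (induction n) simp_all
  show ?thesis unfolding * by (intro comp_intros assms assms[THEN computable_comp])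
qed

lemma computable_valid [comp_intros]:
  assumes "computable A f"
  shows "computable A (\<lambda>x. valid (f x))"
proof -
  have *: "valid \<sigma> = rec_list True (\<lambda>i \<sigma> r. i \<le> length \<sigma> \<and> r) \<sigma>" for \<sigma>
    by (induction \<sigma>) simp_all
  show ?thesis unfolding * by (intro comp_intros assms)
qed

lemma computable_jval [comp_intros]:
  assumes "computable A f1" "computable A f2" "computable A f3"
  shows "computable A (\<lambda>x. jval (f1 x) (f2 x) (f3 x))"
  unfolding jval_def by (intro comp_intros assms)

lemma computable_guess:
  assumes "computable A f1" "computable A f2"
  shows "computable A (\<lambda>x. guess A (f1 x) (f2 x))"
proof -
  have *: "guess A s n = rec_nat [] (\<lambda>n r.
      (LEAST i. i = n \<or> length (base s n (tree s r)) + i \<notin> A) # r) n" for s n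
    by (induction n) simp_all
  show ?thesis
    unfolding * by (intro comp_intros computable_oracle assms assms[THEN computable_comp]) auto
qed

lemma approx_nthd: "approx s x = nthd False (tree s (wits s (Suc x))) x"
  unfolding approx_def nthd_def using less_length_tree_wits[of x s] by (simp only: if_True)

lemma computable_approx [comp_intros]:
  assumes "computable A f1" "computable A f2"
  shows "computable A (\<lambda>x. approx (f1 x) (f2 x))"
  unfolding approx_nthd by (intro comp_intros assms)

lemma computable_power [comp_intros]:
  fixes f g :: "'a::coded \<Rightarrow> nat"
  assumes "computable A f" "computable A g"
  shows "computable A (\<lambda>x. f x ^ g x)"
proof -
  have *: "m ^ n = rec_nat 1 (\<lambda>_ r. m * r) n" for m n :: nat by (induction n) simp_all
  show ?thesis unfolding * by (intro comp_intros assms assms[THEN computable_comp])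
qed

lemma computable_fact [comp_intros]:
  assumes "computable A f"
  shows "computable A (\<lambda>x. fact (f x) :: nat)"
proof -
  have *: "fact n = rec_nat 1 (\<lambda>k r. Suc k * r) n" for n by (induction n) simp_all
  show ?thesis unfolding * by (intro comp_intros assms)
qed

section \<open>Passing from \<open>computable\<close> to the notions in the theorem\<close>

lemma computable1_iff: "computable1 f \<longleftrightarrow> computable {} f"
  by (simp add: computable1_def computable_def)

lemma computable1_imp_computable: "computable1 f \<Longrightarrow> computable A f"
  unfolding computable1_def computable_def using eval_strip by fastforce

lemma rel_computable2I:
  assumes "computable A (\<lambda>p. g (fst p) (snd p))"
  shows "rel_computable2 A g"
proof -
  obtain t where t: "\<And>p. eval A t [enc p] (g (fst p) (snd p))"
    using assms unfolding computable_def enc_nat_def by blast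
  have "eval A (Comp t [pair_rf]) [x, s] (g x s)" for x s
    using t[of "(x, s)"] by (intro eval_comp1 eval_pair_rf) (simp_all add: enc_Pair)
  then show ?thesis unfolding rel_computable2_def by blast
qed

lemma unif_ceI:
  fixes P :: "nat \<Rightarrow> nat \<Rightarrow> nat \<Rightarrow> bool"
  assumes "computable {} (\<lambda>p. P (fst p) (fst (snd p)) (snd (snd p)))"
    and T: "\<And>x y. y \<in> T x \<longleftrightarrow> (\<exists>k. P x y k)"
  shows "unif_ce T"
proof -
  have "computable {} (\<lambda>p. of_bool (\<not> P (fst p) (fst (snd p)) (snd (snd p))) :: nat)"
    by (intro comp_intros assms)
  then obtain t where t:
    "\<And>p. eval {} t [enc p] (of_bool (\<not> P (fst p) (fst (snd p)) (snd (snd p))))"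
    unfolding computable_def enc_nat_def by blast
  define g where "g = Comp t [Comp pair_rf [Proj 1, Comp pair_rf [Proj 2, Proj 0]]]"
  have g: "eval {} g [k, x, y] (of_bool (\<not> P x y k))" for k x y
    unfolding g_def
  proof (rule eval_comp1)
    show "eval {} (Comp pair_rf [Proj 1, Comp pair_rf [Proj 2, Proj 0]]) [k, x, y] (enc (x, (y, k)))"
      by (rule eval_basic eval_pair_rf | simp add: enc_Pair)+
    show "eval {} t [enc (x, (y, k))] (of_bool (\<not> P x y k))" using t[of "(x, (y, k))"] by simp
  qed
  have "y \<in> T x \<longleftrightarrow> (\<exists>z. eval {} (Mn g) [x, y] z)" for x y
  proof
    assume "y \<in> T x"
    then have "\<exists>k. (of_bool (\<not> P x y k) :: nat) = 0" using T by simp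
    then show "\<exists>z. eval {} (Mn g) [x, y] z" using eval_Mn[OF g] by blast
  next
    assume "\<exists>z. eval {} (Mn g) [x, y] z"
    then obtain z where "eval {} (Mn g) [x, y] z" ..
    then have "eval {} g [z, x, y] 0" by (cases rule: eval.cases) auto
    then have "of_bool (\<not> P x y z) = (0 :: nat)" using eval_det g by blast
    then show "y \<in> T x" using T by auto
  qed
  then show ?thesis unfolding unif_ce_def by blast
qed

section \<open>The theorem\<close>

lemma omega_ce_limset: "omega_ce_set limset"
  unfolding omega_ce_set_def omega_ce_fn_def omega_ce_by_def
proof (rule exI, rule exI, intro conjI allI)
  show "rel_computable2 {} (\<lambda>x s. of_bool (approx s x))"
    by (intro rel_computable2I comp_intros)
  show "computable1 (\<lambda>x. fact (Suc x) * 3 ^ Suc x + Suc x * x)"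
    unfolding computable1_iff by (intro comp_intros)
  fix x
  have *: "{t. of_bool (approx t x) \<noteq> (of_bool (approx (Suc t) x) :: nat)} =
    {t. approx t x \<noteq> approx (Suc t) x}" by auto
  show "finite {t. of_bool (approx t x) \<noteq> (of_bool (approx (Suc t) x) :: nat)}"
    unfolding * by (rule approx_changes)
  show "card {t. of_bool (approx t x) \<noteq> (of_bool (approx (Suc t) x) :: nat)}
      \<le> fact (Suc x) * 3 ^ Suc x + Suc x * x"
    unfolding * by (rule approx_changes)
  obtain s0 where "\<forall>s\<ge>s0. approx s x \<longleftrightarrow> x \<in> limset" using approx_eventually by blast
  then show "\<exists>t0. \<forall>t\<ge>t0. of_bool (approx t x) = (if x \<in> limset then 1 else 0 :: nat)"
    by auto
qed

lemma order_fn_fact_power: "order_fn (\<lambda>n. fact n * 3 ^ n)"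
  unfolding order_fn_def
proof (intro conjI allI)
  show "computable1 (\<lambda>n. fact n * 3 ^ n)"
    unfolding computable1_iff by (intro comp_intros)
  show "mono (\<lambda>n. fact n * 3 ^ n :: nat)"
    by (intro monoI mult_mono fact_mono power_increasing) auto
  fix m :: nat
  have "m \<le> 3 ^ m" by (simp add: less_exp less_imp_le less_le_trans power_mono)
  also have "\<dots> \<le> fact m * 3 ^ m" using mult_le_mono1[OF fact_ge_1[of m], of "3 ^ m"] by simp
  finally show "\<exists>n. m \<le> fact n * 3 ^ n" ..
qed

lemma jump_traceable_limset: "jump_traceable limset"
  unfolding jump_traceable_def
proof (intro exI conjI allI impI)
  show "order_fn (\<lambda>n. fact n * 3 ^ n)" by (rule order_fn_fact_power)
  show "unif_ce trace"
  proof (rule unif_ceI)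
    let ?P = "\<lambda>x y k. valid (list_decode (snd (prod_decode k))) \<and>
      length (list_decode (snd (prod_decode k))) = x \<and>
      jval (fst (prod_decode k)) x (tree (fst (prod_decode k)) (list_decode (snd (prod_decode k)))) = Suc y"
    show "computable {} (\<lambda>p. ?P (fst p) (fst (snd p)) (snd (snd p)))"
      by (intro comp_intros)
    show "y \<in> trace x \<longleftrightarrow> (\<exists>k. ?P x y k)" for x y
    proof
      assume "y \<in> trace x"
      then obtain s \<sigma> where "\<sigma> \<in> seqs x" "jval s x (tree s \<sigma>) = Suc y" by (auto simp: trace_def)
      then have "?P x y (prod_encode (s, list_encode \<sigma>))" by (simp add: seqs_def)
      then show "\<exists>k. ?P x y k" ..
    qed (auto simp: trace_def seqs_def)
  qed
  show "finite (trace x)" "card (trace x) \<le> fact x * 3 ^ x" for x by (fact trace_bound)+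
  show "y \<in> trace x" if "J limset x = Some y" for x y
    using that jump_in_trace by (simp add: J_def phi_eq_Some)
qed

definition limwit :: "nat \<Rightarrow> nat" where
  "limwit l = wit (SOME s0. \<forall>s\<ge>s0. wit s l = wit s0 l) l"

lemma wit_limwit: "\<exists>s0. \<forall>s\<ge>s0. wit s l = limwit l"
  using someI_ex[OF wit_eventually_const[of l]] unfolding limwit_def by blast

text \<open>The witnesses are read from the finished set instead of being approximated through their
  history. The readings change only at active stages, which have a computable bound free of the
  opponents' own bounds.\<close>

lemma omega_ce_by_limwit:
  assumes g: "computable limset g" "computable1 g"
  shows "omega_ce_by limset (\<lambda>q. limwit (g q))"
  unfolding omega_ce_by_def
proof (rule exI, rule exI, intro conjI allI)
  let ?\<Gamma> = "\<lambda>q s. hd (guess limset s (Suc (g q)))"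
  show "rel_computable2 limset ?\<Gamma>"
    by (intro rel_computable2I comp_intros computable_guess computable_comp[OF g(1)])
  show "computable1 (\<lambda>q. fact (Suc (g q)) * 3 ^ Suc (g q))"
    using g(2) unfolding computable1_iff by (intro comp_intros)
  fix q
  have sub: "{t. ?\<Gamma> q t \<noteq> ?\<Gamma> q (Suc t)} \<subseteq> active (Suc (g q))"
  proof
    fix t assume t: "t \<in> {t. ?\<Gamma> q t \<noteq> ?\<Gamma> q (Suc t)}"
    show "t \<in> active (Suc (g q))"
    proof (rule ccontr)
      assume "t \<notin> active (Suc (g q))"
      from guess_quiet[OF this order_refl, of limset] show False using t by (simp only: mem_Collect_eq)
    qed
  qed
  show "finite {t. ?\<Gamma> q t \<noteq> ?\<Gamma> q (Suc t)}"
    using sub active_bound(1) by (rule finite_subset)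
  show "card {t. ?\<Gamma> q t \<noteq> ?\<Gamma> q (Suc t)} \<le> fact (Suc (g q)) * 3 ^ Suc (g q)"
    using card_mono[OF active_bound(1) sub] active_bound(2)[of "Suc (g q)"] by linarith
  obtain s0 where s0: "settled (Suc (g q)) s0" using ex_settled by (rule exE)
  obtain s1 where s1: "\<forall>s\<ge>s1. wit s (g q) = limwit (g q)" using wit_limwit[of "g q"] ..
  have "?\<Gamma> q s = limwit (g q)" if "s \<ge> max s0 s1" for s
  proof -
    have "guess limset s (Suc (g q)) = wits s (Suc (g q))"
      by (rule guess_eq_wits[OF s0 _ order_refl]) (use that in simp)
    then have "?\<Gamma> q s = wit s (g q)" by (simp only: wits.simps list.sel)
    then show ?thesis using s1 that by simp
  qed
  then show "\<exists>t0. \<forall>t\<ge>t0. ?\<Gamma> q t = limwit (g q)" by blast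
qed

lemma ex_opponent:
  assumes "rel_computable2 {} \<Gamma>" "computable1 b"
  shows "\<exists>q. \<forall>x t. eval {} (decode q) [x, t] (prod_encode (b x, \<Gamma> x t))"
proof -
  obtain t\<Gamma> tb where t: "\<And>x s. eval {} t\<Gamma> [x, s] (\<Gamma> x s)" "\<And>x. eval {} tb [x] (b x)"
    using assms unfolding rel_computable2_def computable1_def by blast
  obtain q where q: "decode q = Comp pair_rf [Comp tb [Proj 0], t\<Gamma>]" using decode_surj by blast
  have "eval {} (decode q) [x, s] (prod_encode (b x, \<Gamma> x s))" for x s
    unfolding q by (rule eval_comp2 eval_comp1 eval_Proj t eval_pair_rf refl | simp)+
  then show ?thesis by blast
qed

text \<open>An opponent that keeps its bound is never abandoned. As \<open>v\<close> elements cannot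
  exhaust \<open>{..v}\<close>, the least number outside \<open>W r\<close> is at most
  \<open>v\<close>, and the capped search eventually stays there.\<close>

lemma limwit_notin_W:
  assumes q: "\<And>t. eval {} (decode q) [q, t] (prod_encode (B, \<rho> t))"
    and fin: "finite {t. \<rho> t \<noteq> \<rho> (Suc t)}" and card: "card {t. \<rho> t \<noteq> \<rho> (Suc t)} \<le> B"
    and lim: "\<forall>t\<ge>t0. \<rho> t = r" and W: "finite (W r)" "card (W r) \<le> v"
  shows "limwit (prod_encode (q, v)) \<notin> W r"
proof -
  have ev: "ev0 s q [q, t] = Suc (prod_encode (B, \<rho> t))" if t: "t < tlen s q" for s t
  proof -
    obtain y where y: "ev0 s q [q, t] = Suc y" using ev0_below_tlen[OF t] not0_implies_Suc by blast
    then show ?thesis using eval_det[OF ev0_sound[OF y] q] by simp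
  qed
  have idx: "idx s q t = \<rho> t" if "t < tlen s q" for s t using ev[OF that] by (simp add: idx_def)
  have bnd: "bnd s q = B" if "0 < tlen s q" for s using ev[OF that] by (simp add: bnd_def)
  have chg: "chg s q \<le> B" for s
  proof -
    have "chg s q = length (filter (\<lambda>t. \<rho> t \<noteq> \<rho> (Suc t)) [0..<tlen s q - 1])"
      unfolding chg_def using idx[of _ s] by (intro arg_cong[where f = length] filter_cong) auto
    also have "\<dots> = card (set (filter (\<lambda>t. \<rho> t \<noteq> \<rho> (Suc t)) [0..<tlen s q - 1]))"
      by (simp only: distinct_card distinct_filter distinct_upt)
    also have "\<dots> \<le> card {t. \<rho> t \<noteq> \<rho> (Suc t)}" by (rule card_mono[OF fin]) auto
    finally show ?thesis using card by simp
  qed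
  have "\<forall>\<^sub>F s in sequentially. \<forall>t\<in>{..t0}. ev0 s q [q, t] \<noteq> 0"
  proof (intro eventually_ball_finite ballI)
    fix t
    from ev0_complete[OF q[of t]] show "\<forall>\<^sub>F s in sequentially. ev0 s q [q, t] \<noteq> 0"
      by eventually_elim simp
  qed simp
  \<comment> \<open>The index in use is the approximation at \<open>tlen s q - 1\<close>, so
    \<open>t0 < tlen s q\<close> ensures that it is the final one.\<close>
  then have tlen: "\<forall>\<^sub>F s in sequentially. t0 < tlen s q"
    using eventually_ge_at_top[of "Suc t0"]
    by eventually_elim (use le_tlenI[of "Suc t0"] in \<open>auto simp: Suc_le_eq\<close>)
  have "\<not> {..v} \<subseteq> W r" using card_mono[OF W(1), of "{..v}"] W(2) by auto
  then obtain j where j: "j \<notin> W r" "j \<le> v" by auto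
  define i0 where "i0 = (LEAST i. i \<notin> W r)"
  have i0: "i0 \<notin> W r" unfolding i0_def using j(1) by (rule LeastI)
  have i0_le: "i0 \<le> v" unfolding i0_def using Least_le[of "\<lambda>i. i \<notin> W r", OF j(1)] j(2) by simp
  have "\<forall>\<^sub>F s in sequentially. ev0 s r [i] \<noteq> 0" if "i < i0" for i
  proof -
    have "i \<in> W r" using not_less_Least[of i "\<lambda>i. i \<notin> W r"] that unfolding i0_def by blast
    then obtain y where "eval {} (decode r) [i] y" by (auto simp: W_def)
    from ev0_complete[OF this] show ?thesis by eventually_elim simp
  qed
  then have "\<forall>\<^sub>F s in sequentially. \<forall>i\<in>{..<i0}. ev0 s r [i] \<noteq> 0"
    by (intro eventually_ball_finite) auto
  with tlen have "\<forall>\<^sub>F s in sequentially. wit s (prod_encode (q, v)) = i0"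
  proof eventually_elim
    case (elim s)
    have "cur s q = \<rho> (tlen s q - 1)" unfolding cur_def by (rule idx) (use elim in simp)
    also have "\<dots> = r" using lim elim by auto
    finally have cur: "cur s q = r" .
    have "ev0 s r [i0] = 0"
    proof (rule ccontr)
      assume "ev0 s r [i0] \<noteq> 0"
      then obtain y where "ev0 s r [i0] = Suc y" using not0_implies_Suc by blast
      then show False using i0 ev0_sound unfolding W_def by blast
    qed
    have "(LEAST i. i = v \<or> ev0 s r [i] = 0) = i0"
    proof (rule Least_equality)
      show "i0 = v \<or> ev0 s r [i0] = 0" using \<open>ev0 s r [i0] = 0\<close> by simp
      show "i0 \<le> i" if "i = v \<or> ev0 s r [i] = 0" for i
        using that elim(2) i0_le by (meson lessThan_iff not_le)
    qed
    then show ?case using elim(1) bnd[of s] chg[of s] cur by (simp add: wit_def)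
  qed
  moreover have "\<forall>\<^sub>F s in sequentially. wit s (prod_encode (q, v)) = limwit (prod_encode (q, v))"
    unfolding eventually_sequentially by (rule wit_limwit)
  ultimately have "\<forall>\<^sub>F s in sequentially. limwit (prod_encode (q, v)) = i0"
    by eventually_elim simp
  then show ?thesis using i0 by simp
qed

text \<open>The function depends on \<open>h\<close> alone and is fixed before the trace is given. A
  trace together with its bound is then some opponent \<open>q\<close>, and it fails at the argument
  \<open>q\<close>.\<close>

lemma not_BLR_traceable_limset: "\<not> BLR_traceable limset"
proof
  assume "BLR_traceable limset"
  then obtain h where h: "order_fn h" and trace: "\<And>f. omega_ce_by limset f \<Longrightarrow>
      \<exists>r. omega_ce_fn r \<and> (\<forall>n. finite (W (r n)) \<and> card (W (r n)) \<le> h n \<and> f n \<in> W (r n))"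
    unfolding BLR_traceable_def by blast
  have h1: "computable1 h" using h by (simp add: order_fn_def)
  have g: "computable A (\<lambda>q. prod_encode (q, h q))" for A
    by (intro comp_intros computable1_imp_computable h1)
  have "omega_ce_by limset (\<lambda>q. limwit (prod_encode (q, h q)))"
    by (rule omega_ce_by_limwit) (simp_all add: g computable1_iff)
  from trace[OF this] obtain r where r: "omega_ce_fn r"
    and Wr: "\<And>n. finite (W (r n))" "\<And>n. card (W (r n)) \<le> h n"
      "\<And>n. limwit (prod_encode (n, h n)) \<in> W (r n)" by blast
  from r obtain \<Gamma> b where \<Gamma>: "rel_computable2 {} \<Gamma>" "computable1 b"
    "\<And>x. finite {t. \<Gamma> x t \<noteq> \<Gamma> x (Suc t)}" "\<And>x. card {t. \<Gamma> x t \<noteq> \<Gamma> x (Suc t)} \<le> b x"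
    "\<And>x. \<exists>t0. \<forall>t\<ge>t0. \<Gamma> x t = r x"
    unfolding omega_ce_fn_def omega_ce_by_def by blast
  obtain q where q: "\<And>x t. eval {} (decode q) [x, t] (prod_encode (b x, \<Gamma> x t))"
    using ex_opponent[OF \<Gamma>(1,2)] by blast
  obtain t0 where "\<forall>t\<ge>t0. \<Gamma> q t = r q" using \<Gamma>(5)[of q] ..
  from limwit_notin_W[of q "b q" "\<Gamma> q", OF q \<Gamma>(3,4) this Wr(1,2)] Wr(3)[of q] show False by simp
qed

theorem mainTheorem7:
  shows "\<exists>A :: nat set. omega_ce_set A \<and> jump_traceable A \<and> \<not> BLR_traceable A"
  using omega_ce_limset jump_traceable_limset not_BLR_traceable_limset by blast

end
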